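(* For any finite-dimensional irreducible $\mathfrak H$-module $V$, the $\Re$-module $V$ (obtained by pulling back via $\zeta$) is completely reducible if and only if $t_0$ is diagonalizable on $V$.
   Context: Throughout, $\mathbb F$ is an algebraically closed field of characteristic zero; algebras are associative with unit $1$, and $[X,Y]=XY-YX$. The universal Racah algebra $\Re$ is the $\mathbb F$-algebra with generators $A,B,C,D$ and relations stating that $[A,B]=[B,C]=[C,A]=2D$ and that each of $[A,D]+AC-BA$, $[B,D]+BA-CB$, $[C,D]+CB-AC$ commutes with $A,B,C,D$. The universal additive DAHA $\mathfrak H$ of type $(C_1^\vee,C_1)$ is the $\mathbb F$-algebra with generators $t_0,t_1,t_0^\vee,t_1^\vee$ and relations stating that $t_0+t_1+t_0^\vee+t_1^\vee=-1$ and that each of $t_0^2,\ t_1^2,\ (t_0^{\vee})^2,\ (t_1^{\vee})^2$ commutes with $t_0,t_1,t_0^\vee,t_1^\vee$. There is a unique $\mathbb F$-algebra homomorphism $\zeta:\Re\to\mathfrak H$ with $$A\mapsto \frac{(t_1^\vee+t_0^\vee)(t_1^\vee+t_0^\vee+2)}{4},\quad B\mapsto \frac{(t_1+t_1^\vee)(t_1+t_1^\vee+2)}{4},\quad C\mapsto \frac{(t_0^\vee+t_1)(t_0^\vee+t_1+2)}{4}.$$ *)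

theory Defs
  imports "HOL-Computational_Algebra.Polynomial" "HOL-Library.Poly_Mapping"
begin

definition comm :: "'a::ring \<Rightarrow> 'a \<Rightarrow> 'a" where
  "comm x y = x * y - y * x"

section \<open>Algebras, modules, free algebras\<close>

locale unital_algebra = vector_space scale
  for scale :: "'f::field \<Rightarrow> 'a::ring_1 \<Rightarrow> 'a" +
  assumes scale_mult_left: "scale c x * y = scale c (x * y)"
    and scale_mult_right: "x * scale c y = scale c (x * y)"

definition algebra_hom ::
    "('f::field \<Rightarrow> 'a::ring_1 \<Rightarrow> 'a) \<Rightarrow> ('f \<Rightarrow> 'b::ring_1 \<Rightarrow> 'b) \<Rightarrow> ('a \<Rightarrow> 'b) \<Rightarrow> bool" where
  "algebra_hom s1 s2 f \<longleftrightarrow>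
    Vector_Spaces.linear s1 s2 f \<and> f 1 = 1 \<and> (\<forall>x y. f (x * y) = f x * f y)"

locale algebra_module =
  A: unital_algebra scaleA + V: vector_space scaleV
  for scaleA :: "'f::field \<Rightarrow> 'a::ring_1 \<Rightarrow> 'a"
    and scaleV :: "'f \<Rightarrow> 'v::ab_group_add \<Rightarrow> 'v" +
  fixes act :: "'a \<Rightarrow> 'v \<Rightarrow> 'v"
  assumes act_add_left: "act (x + y) v = act x v + act y v"
    and act_add_right: "act x (v + w) = act x v + act x w"
    and act_mult: "act (x * y) v = act x (act y v)"
    and act_one: "act 1 v = v"
    and act_scale_left: "act (scaleA c x) v = scaleV c (act x v)"
    and act_scale_right: "act x (scaleV c v) = scaleV c (act x v)"
begin

definition submodule :: "'v set \<Rightarrow> bool" where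
  "submodule W \<longleftrightarrow> V.subspace W \<and> (\<forall>x. \<forall>w\<in>W. act x w \<in> W)"

definition irreducible_submodule :: "'v set \<Rightarrow> bool" where
  "irreducible_submodule W \<longleftrightarrow> submodule W \<and> W \<noteq> {0} \<and>
    (\<forall>U. submodule U \<and> U \<subseteq> W \<longrightarrow> U = {0} \<or> U = W)"

definition irreducible_module :: bool where
  "irreducible_module \<longleftrightarrow> irreducible_submodule UNIV"

(* The module is the (internal) direct sum of a family of irreducible submodules.  A set of
   submodules suffices in place of an indexed family, because the members of a direct sum
   are nonzero and hence pairwise distinct. *)
definition completely_reducible :: bool where
  "completely_reducible \<longleftrightarrow>
    (\<exists>\<S>. (\<forall>W\<in>\<S>. irreducible_submodule W) \<and>
         (\<forall>W\<in>\<S>. W \<inter> V.span (\<Union>(\<S> - {W})) = {0}) \<and>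
         V.span (\<Union>\<S>) = UNIV)"

end

definition finite_dimensional :: "('f::field \<Rightarrow> 'v::ab_group_add \<Rightarrow> 'v) \<Rightarrow> bool" where
  "finite_dimensional scale \<longleftrightarrow> (\<exists>B. finite_dimensional_vector_space scale B)"

definition diagonalizable ::
    "('f::field \<Rightarrow> 'v::ab_group_add \<Rightarrow> 'v) \<Rightarrow> ('v \<Rightarrow> 'v) \<Rightarrow> bool" where
  "diagonalizable scale T \<longleftrightarrow>
    (\<exists>B. \<not> module.dependent scale B \<and> module.span scale B = UNIV \<and>
         (\<forall>v\<in>B. \<exists>c. T v = scale c v))"

(* The free monoid on 'g, written additively so that the convolution product of finitely
   supported functions makes ('g free_word, 'f) poly_mapping the free associative algebra on 'g. *)
datatype 'g free_word = Word (letters: "'g list")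

instantiation free_word :: (type) monoid_add
begin
definition "0 = Word []"
definition "v + w = Word (letters v @ letters w)"
instance by standard (simp_all add: zero_free_word_def plus_free_word_def)
end

type_synonym ('g, 'f) free_algebra = "('g free_word, 'f) poly_mapping"

definition gen :: "'g \<Rightarrow> ('g, 'f::field) free_algebra" where
  "gen g = Poly_Mapping.single (Word [g]) 1"

definition free_scale :: "'f::field \<Rightarrow> ('g, 'f) free_algebra \<Rightarrow> ('g, 'f) free_algebra" where
  "free_scale c p = Poly_Mapping.single 0 c * p"

inductive_set two_sided_ideal :: "'a::ring_1 set \<Rightarrow> 'a set" for R where
  base: "r \<in> R \<Longrightarrow> r \<in> two_sided_ideal R"
| zero: "0 \<in> two_sided_ideal R"
| add: "x \<in> two_sided_ideal R \<Longrightarrow> y \<in> two_sided_ideal R \<Longrightarrow> x + y \<in> two_sided_ideal R"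
| mult_left: "x \<in> two_sided_ideal R \<Longrightarrow> a * x \<in> two_sided_ideal R"
| mult_right: "x \<in> two_sided_ideal R \<Longrightarrow> x * a \<in> two_sided_ideal R"

lemma ideal_uminus: "x \<in> two_sided_ideal R \<Longrightarrow> - x \<in> two_sided_ideal R"
  using two_sided_ideal.mult_left[of x R "-1"] by simp

lemma ideal_diff:
  "x \<in> two_sided_ideal R \<Longrightarrow> y \<in> two_sided_ideal R \<Longrightarrow> x - y \<in> two_sided_ideal R"
  using two_sided_ideal.add[of x R "-y"] ideal_uminus[of y R] by simp

lemma ideal_equivp: "equivp (\<lambda>x y. x - y \<in> two_sided_ideal R)"
proof (rule equivpI)
  show "reflp (\<lambda>x y. x - y \<in> two_sided_ideal R)"
    by (simp add: reflp_def two_sided_ideal.zero)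
  show "symp (\<lambda>x y. x - y \<in> two_sided_ideal R)"
    using ideal_uminus by (metis (no_types, lifting) minus_diff_eq sympI)
  show "transp (\<lambda>x y. x - y \<in> two_sided_ideal R)"
    using two_sided_ideal.add by (metis (no_types, lifting) diff_add_cancel diff_add_eq_diff_diff_swap
      add_diff_eq transpI)
qed

lemma ideal_cong_add:
  assumes "x - x' \<in> two_sided_ideal R" "y - y' \<in> two_sided_ideal R"
  shows "(x + y) - (x' + y') \<in> two_sided_ideal R"
  using two_sided_ideal.add[OF assms] by (simp add: algebra_simps)

lemma ideal_cong_diff:
  assumes "x - x' \<in> two_sided_ideal R" "y - y' \<in> two_sided_ideal R"
  shows "(x - y) - (x' - y') \<in> two_sided_ideal R"
  using ideal_diff[OF assms] by (simp add: algebra_simps)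

lemma ideal_cong_uminus:
  assumes "x - x' \<in> two_sided_ideal R"
  shows "(- x) - (- x') \<in> two_sided_ideal R"
  using ideal_uminus[OF assms] by (simp add: algebra_simps)

lemma ideal_cong_mult:
  assumes "x - x' \<in> two_sided_ideal R" "y - y' \<in> two_sided_ideal R"
  shows "(x * y) - (x' * y') \<in> two_sided_ideal R"
proof -
  have "(x * y) - (x' * y') = (x - x') * y + x' * (y - y')"
    by (simp add: algebra_simps)
  then show ?thesis
    using assms by (simp add: two_sided_ideal.intros)
qed

lemma ideal_cong_free_scale:
  assumes "x - x' \<in> two_sided_ideal R"
  shows "free_scale c x - free_scale c x' \<in> two_sided_ideal R"
  unfolding free_scale_def
  using two_sided_ideal.mult_left[OF assms] by (simp add: algebra_simps)

lemma single_zero_commute: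
  "Poly_Mapping.single (0::'g free_word) (c::'f::field) * p = p * Poly_Mapping.single 0 c"
proof (induction p rule: update_induct)
  case const
  then show ?case by simp
next
  case (update p a b)
  have "Poly_Mapping.update a b p = p + Poly_Mapping.single a b"
    using update(1)
    by (intro poly_mapping_eqI) (auto simp: lookup_update lookup_add lookup_single in_keys_iff when_def)
  then show ?case
    using update by (simp add: algebra_simps mult_single)
qed

lemma unital_algebra_free: "unital_algebra (free_scale :: 'f::field \<Rightarrow> ('g, 'f) free_algebra \<Rightarrow> _)"
  unfolding free_scale_def
proof unfold_locales
  fix c :: 'f and x y :: "('g, 'f) free_algebra"
  show "x * (Poly_Mapping.single 0 c * y) = Poly_Mapping.single 0 c * (x * y)"
    by (metis mult.assoc single_zero_commute)
qed (simp_all add: algebra_simps single_add mult_single flip: mult.assoc)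

subsection \<open>Universal property of the free algebra\<close>

definition free_lift ::
    "('f::field \<Rightarrow> 'a::ring_1 \<Rightarrow> 'a) \<Rightarrow> ('g \<Rightarrow> 'a) \<Rightarrow> ('g, 'f) free_algebra \<Rightarrow> 'a" where
  "free_lift scale f p =
    (\<Sum>w\<in>Poly_Mapping.keys p. scale (Poly_Mapping.lookup p w) (prod_list (map f (letters w))))"

lemma free_algebra_induct [case_names zero monom add]:
  fixes p :: "('g, 'f::field) free_algebra"
  assumes "Q 0" and "\<And>w c. Q (Poly_Mapping.single w c)"
    and "\<And>p q. Q p \<Longrightarrow> Q q \<Longrightarrow> Q (p + q)"
  shows "Q p"
proof (induction p rule: update_induct)
  case const
  then show ?case using assms(1) by simp
next
  case (update p a b)
  have "Poly_Mapping.update a b p = p + Poly_Mapping.single a b"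
    using update(1)
    by (intro poly_mapping_eqI) (auto simp: lookup_update lookup_add lookup_single in_keys_iff when_def)
  then show ?case
    using update assms by simp
qed

context unital_algebra
begin

lemma free_lift_superset:
  assumes "finite S" "Poly_Mapping.keys p \<subseteq> S"
  shows "free_lift scale f p = (\<Sum>w\<in>S. scale (Poly_Mapping.lookup p w) (prod_list (map f (letters w))))"
  unfolding free_lift_def
  using assms by (intro sum.mono_neutral_left) (auto simp: in_keys_iff)

lemma free_lift_add: "free_lift scale f (p + q) = free_lift scale f p + free_lift scale f q"
proof -
  have "Poly_Mapping.keys (p + q) \<subseteq> Poly_Mapping.keys p \<union> Poly_Mapping.keys q" by (rule keys_add)
  then show ?thesis
    by (simp add: free_lift_superset[of "Poly_Mapping.keys p \<union> Poly_Mapping.keys q"] lookup_add scale_left_distrib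
        sum.distrib)
qed

lemma free_lift_zero: "free_lift scale f 0 = 0"
  by (simp add: free_lift_def)

lemma free_lift_single:
  "free_lift scale f (Poly_Mapping.single w c) = scale c (prod_list (map f (letters w)))"
  by (subst free_lift_superset[of "{w}"]) auto

lemma free_lift_gen: "free_lift scale f (gen g) = f g"
  by (simp add: gen_def free_lift_single)

lemma free_lift_one: "free_lift scale f 1 = 1"
  by (simp add: free_lift_single zero_free_word_def flip: single_one)

lemma free_lift_uminus: "free_lift scale f (- p) = - free_lift scale f p"
  using free_lift_add[of f p "-p"] by (simp add: free_lift_zero eq_neg_iff_add_eq_0 add.commute)

lemma free_lift_diff: "free_lift scale f (p - q) = free_lift scale f p - free_lift scale f q"
  using free_lift_add[of f p "-q"] by (simp add: free_lift_uminus)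

lemma free_lift_mult: "free_lift scale f (p * q) = free_lift scale f p * free_lift scale f q"
proof (induction p rule: free_algebra_induct)
  case (monom w c)
  show ?case
    by (induction q rule: free_algebra_induct)
      (simp_all add: free_lift_zero free_lift_add free_lift_single mult_single plus_free_word_def
        distrib_left scale_mult_left scale_mult_right mult.commute)
qed (simp_all add: free_lift_zero free_lift_add distrib_right)

lemma free_lift_scale: "free_lift scale f (free_scale c p) = scale c (free_lift scale f p)"
  by (simp add: free_scale_def free_lift_mult free_lift_single zero_free_word_def scale_mult_left)

lemma free_lift_numeral: "free_lift scale f (numeral k) = numeral k"
  by (induction k) (simp_all only: free_lift_one free_lift_add numeral.simps)

lemmas free_lift_simps = free_lift_add free_lift_zero free_lift_gen free_lift_one
  free_lift_uminus free_lift_diff free_lift_mult free_lift_scale free_lift_numeral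

lemma free_lift_ideal:
  assumes "\<And>r. r \<in> R \<Longrightarrow> free_lift scale f r = 0" and "x \<in> two_sided_ideal R"
  shows "free_lift scale f x = 0"
  using assms(2) by induction (simp_all add: assms(1) free_lift_simps)

end

lemma unital_algebra_field: "unital_algebra ((*) :: 'f::field \<Rightarrow> 'f \<Rightarrow> 'f)"
  by unfold_locales (simp_all add: algebra_simps)

lemma free_algebra_gen_induct [case_names one gen scale add mult]:
  fixes p :: "('g, 'f::field) free_algebra"
  assumes one: "Q 1" and gen: "\<And>g. Q (gen g)"
    and scale: "\<And>c p. Q p \<Longrightarrow> Q (free_scale c p)"
    and add: "\<And>p q. Q p \<Longrightarrow> Q q \<Longrightarrow> Q (p + q)" and mult: "\<And>p q. Q p \<Longrightarrow> Q q \<Longrightarrow> Q (p * q)"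
  shows "Q p"
proof (induction p rule: free_algebra_induct)
  case zero
  show ?case using scale[OF one, of 0] by (simp add: free_scale_def)
next
  case (monom w c)
  have "Q (Poly_Mapping.single (Word l) 1)" for l :: "'g list"
  proof (induction l)
    case Nil
    show ?case using one by (simp add: zero_free_word_def flip: single_one)
  next
    case (Cons g l)
    have "Poly_Mapping.single (Word (g # l)) 1 = gen g * Poly_Mapping.single (Word l) (1::'f)"
      by (simp add: gen_def mult_single plus_free_word_def)
    then show ?case using Cons gen mult by simp
  qed
  from scale[OF this, of c "letters w"] show ?case
    by (simp add: free_scale_def mult_single)
qed (rule add)

section \<open>The universal Racah algebra\<close>

datatype racah_gen = Racah_A | Racah_B | Racah_C | Racah_D

definition racah_relators :: "'a::ring_1 \<Rightarrow> 'a \<Rightarrow> 'a \<Rightarrow> 'a \<Rightarrow> 'a set" where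
  "racah_relators A B C D =
    {comm A B - 2 * D, comm B C - 2 * D, comm C A - 2 * D} \<union>
    {comm x g | x g. x \<in> {comm A D + A * C - B * A, comm B D + B * A - C * B,
                          comm C D + C * B - A * C} \<and> g \<in> {A, B, C, D}}"

abbreviation racah_ideal :: "(racah_gen, 'f::field) free_algebra set" where
  "racah_ideal \<equiv> two_sided_ideal
    (racah_relators (gen Racah_A) (gen Racah_B) (gen Racah_C) (gen Racah_D))"

quotient_type (overloaded) 'f racah = "(racah_gen, 'f::field) free_algebra" / "\<lambda>x y. x - y \<in> racah_ideal"
  by (rule ideal_equivp)

instantiation racah :: (field) ring_1
begin

lift_definition zero_racah :: "'a racah" is 0 .
lift_definition one_racah :: "'a racah" is 1 .
lift_definition plus_racah :: "'a racah \<Rightarrow> 'a racah \<Rightarrow> 'a racah" is "(+)" by (rule ideal_cong_add)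
lift_definition minus_racah :: "'a racah \<Rightarrow> 'a racah \<Rightarrow> 'a racah" is "(-)" by (rule ideal_cong_diff)
lift_definition uminus_racah :: "'a racah \<Rightarrow> 'a racah" is uminus by (rule ideal_cong_uminus)
lift_definition times_racah :: "'a racah \<Rightarrow> 'a racah \<Rightarrow> 'a racah" is "(*)" by (rule ideal_cong_mult)

instance
proof
  show "(0::'a racah) \<noteq> 1"
  proof (transfer, rule notI)
    assume "0 - 1 \<in> (racah_ideal :: (racah_gen, 'a) free_algebra set)"
    then have "free_lift ((*) :: 'a \<Rightarrow> 'a \<Rightarrow> 'a) (\<lambda>_. 0) (0 - 1 :: (racah_gen, 'a) free_algebra) = 0"
      by (rule unital_algebra.free_lift_ideal[OF unital_algebra_field, rotated])
        (auto simp: racah_relators_def comm_def unital_algebra.free_lift_simps[OF unital_algebra_field])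
    then show False
      by (simp add: unital_algebra.free_lift_simps[OF unital_algebra_field] del: diff_0)
  qed
qed (transfer; simp add: algebra_simps two_sided_ideal.zero)+

end

lift_definition racah_scale :: "'f::field \<Rightarrow> 'f racah \<Rightarrow> 'f racah" is free_scale
  by (rule ideal_cong_free_scale)

lift_definition rA :: "'f::field racah" is "gen Racah_A" .
lift_definition rB :: "'f::field racah" is "gen Racah_B" .
lift_definition rC :: "'f::field racah" is "gen Racah_C" .
lift_definition rD :: "'f::field racah" is "gen Racah_D" .

section \<open>The universal additive DAHA of type \<open>(C\<^sub>1\<^sup>\<or>, C\<^sub>1)\<close>\<close>

datatype daha_gen = Gen_t0 | Gen_t1 | Gen_t0v | Gen_t1v

definition daha_relators :: "'a::ring_1 \<Rightarrow> 'a \<Rightarrow> 'a \<Rightarrow> 'a \<Rightarrow> 'a set" where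
  "daha_relators s0 s1 s0v s1v =
    {s0 + s1 + s0v + s1v + 1} \<union>
    {comm (x^2) g | x g. x \<in> {s0, s1, s0v, s1v} \<and> g \<in> {s0, s1, s0v, s1v}}"

abbreviation daha_ideal :: "(daha_gen, 'f::field) free_algebra set" where
  "daha_ideal \<equiv> two_sided_ideal
    (daha_relators (gen Gen_t0) (gen Gen_t1) (gen Gen_t0v) (gen Gen_t1v))"

quotient_type (overloaded) 'f daha = "(daha_gen, 'f::field) free_algebra" / "\<lambda>x y. x - y \<in> daha_ideal"
  by (rule ideal_equivp)

instantiation daha :: (field) ring_1
begin

lift_definition zero_daha :: "'a daha" is 0 .
lift_definition one_daha :: "'a daha" is 1 .
lift_definition plus_daha :: "'a daha \<Rightarrow> 'a daha \<Rightarrow> 'a daha" is "(+)" by (rule ideal_cong_add)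
lift_definition minus_daha :: "'a daha \<Rightarrow> 'a daha \<Rightarrow> 'a daha" is "(-)" by (rule ideal_cong_diff)
lift_definition uminus_daha :: "'a daha \<Rightarrow> 'a daha" is uminus by (rule ideal_cong_uminus)
lift_definition times_daha :: "'a daha \<Rightarrow> 'a daha \<Rightarrow> 'a daha" is "(*)" by (rule ideal_cong_mult)

instance
proof
  show "(0::'a daha) \<noteq> 1"
  proof (transfer, rule notI)
    assume "0 - 1 \<in> (daha_ideal :: (daha_gen, 'a) free_algebra set)"
    then have "free_lift ((*) :: 'a \<Rightarrow> 'a \<Rightarrow> 'a) (\<lambda>g. if g = Gen_t0 then -1 else 0)
        (0 - 1 :: (daha_gen, 'a) free_algebra) = 0"
      by (rule unital_algebra.free_lift_ideal[OF unital_algebra_field, rotated])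
        (auto simp: daha_relators_def comm_def power2_eq_square
          unital_algebra.free_lift_simps[OF unital_algebra_field])
    then show False
      by (simp add: unital_algebra.free_lift_simps[OF unital_algebra_field] del: diff_0)
  qed
qed (transfer; simp add: algebra_simps two_sided_ideal.zero)+

end

lift_definition daha_scale :: "'f::field \<Rightarrow> 'f daha \<Rightarrow> 'f daha" is free_scale
  by (rule ideal_cong_free_scale)

lift_definition t0 :: "'f::field daha" is "gen Gen_t0" .
lift_definition t1 :: "'f::field daha" is "gen Gen_t1" .
lift_definition t0v :: "'f::field daha" is "gen Gen_t0v" .
lift_definition t1v :: "'f::field daha" is "gen Gen_t1v" .

lemma unital_algebra_racah: "unital_algebra (racah_scale :: 'f::field \<Rightarrow> 'f racah \<Rightarrow> 'f racah)"
proof -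
  interpret F: unital_algebra "free_scale :: 'f \<Rightarrow> (racah_gen, 'f) free_algebra \<Rightarrow> _"
    by (rule unital_algebra_free)
  show ?thesis
    by unfold_locales
      (transfer; simp add: F.scale_left_distrib F.scale_right_distrib F.scale_mult_left
        F.scale_mult_right two_sided_ideal.zero)+
qed

lemma unital_algebra_daha: "unital_algebra (daha_scale :: 'f::field \<Rightarrow> 'f daha \<Rightarrow> 'f daha)"
proof -
  interpret F: unital_algebra "free_scale :: 'f \<Rightarrow> (daha_gen, 'f) free_algebra \<Rightarrow> _"
    by (rule unital_algebra_free)
  show ?thesis
    by unfold_locales
      (transfer; simp add: F.scale_left_distrib F.scale_right_distrib F.scale_mult_left
        F.scale_mult_right two_sided_ideal.zero)+
qed

interpretation racah: unital_algebra "racah_scale :: 'f::field \<Rightarrow> 'f racah \<Rightarrow> 'f racah"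
  by (rule unital_algebra_racah)

interpretation daha: unital_algebra "daha_scale :: 'f::field \<Rightarrow> 'f daha \<Rightarrow> 'f daha"
  by (rule unital_algebra_daha)

lemma racah_induct [case_names one A B C D scale add mult]:
  fixes x :: "'f::field racah"
  assumes "Q 1" "Q rA" "Q rB" "Q rC" "Q rD"
    and scale: "\<And>c x. Q x \<Longrightarrow> Q (racah_scale c x)"
    and add: "\<And>x y. Q x \<Longrightarrow> Q y \<Longrightarrow> Q (x + y)" and mult: "\<And>x y. Q x \<Longrightarrow> Q y \<Longrightarrow> Q (x * y)"
  shows "Q x"
proof -
  have "Q (abs_racah p)" for p
  proof (induction p rule: free_algebra_gen_induct)
    case one
    show ?case using assms(1) by (simp add: one_racah_def)
  next
    case (gen g)
    show ?case using assms(2-5) by (cases g) (simp_all add: rA_def rB_def rC_def rD_def)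
  next
    case (scale c p)
    then show ?case using assms(6)[of "abs_racah p" c] by (simp add: racah_scale.abs_eq)
  next
    case (add p q)
    then show ?case using assms(7)[of "abs_racah p" "abs_racah q"] by (simp add: plus_racah.abs_eq)
  next
    case (mult p q)
    then show ?case using assms(8)[of "abs_racah p" "abs_racah q"] by (simp add: times_racah.abs_eq)
  qed
  then show ?thesis by (induct x rule: racah.abs_induct)
qed

lemma daha_induct [case_names one t0 t1 t0v t1v scale add mult]:
  fixes x :: "'f::field daha"
  assumes "Q 1" "Q t0" "Q t1" "Q t0v" "Q t1v"
    and scale: "\<And>c x. Q x \<Longrightarrow> Q (daha_scale c x)"
    and add: "\<And>x y. Q x \<Longrightarrow> Q y \<Longrightarrow> Q (x + y)" and mult: "\<And>x y. Q x \<Longrightarrow> Q y \<Longrightarrow> Q (x * y)"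
  shows "Q x"
proof -
  have "Q (abs_daha p)" for p
  proof (induction p rule: free_algebra_gen_induct)
    case one
    show ?case using assms(1) by (simp add: one_daha_def)
  next
    case (gen g)
    show ?case using assms(2-5) by (cases g) (simp_all add: t0_def t1_def t0v_def t1v_def)
  next
    case (scale c p)
    then show ?case using assms(6)[of "abs_daha p" c] by (simp add: daha_scale.abs_eq)
  next
    case (add p q)
    then show ?case using assms(7)[of "abs_daha p" "abs_daha q"] by (simp add: plus_daha.abs_eq)
  next
    case (mult p q)
    then show ?case using assms(8)[of "abs_daha p" "abs_daha q"] by (simp add: times_daha.abs_eq)
  qed
  then show ?thesis by (induct x rule: daha.abs_induct)
qed

lemma comm_set_image:
  assumes "\<And>x y. h (x - y) = h x - h y" "\<And>x y. h (x * y) = h x * h y"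
  shows "{comm x g | x g. x \<in> h ` S \<and> g \<in> h ` T} = h ` {comm x g | x g. x \<in> S \<and> g \<in> T}"
proof -
  have *: "h (comm x g) = comm (h x) (h g)" for x g
    by (simp add: comm_def assms)
  show ?thesis
  proof (intro set_eqI iffI)
    fix y
    assume "y \<in> {comm x g | x g. x \<in> h ` S \<and> g \<in> h ` T}"
    then obtain x g where "x \<in> S" "g \<in> T" "y = h (comm x g)"
      using * by auto
    then show "y \<in> h ` {comm x g | x g. x \<in> S \<and> g \<in> T}" by blast
  next
    fix y
    assume "y \<in> h ` {comm x g | x g. x \<in> S \<and> g \<in> T}"
    then show "y \<in> {comm x g | x g. x \<in> h ` S \<and> g \<in> h ` T}"
      using * by blast
  qed
qed

lemma racah_relators_image:
  fixes h :: "'a::ring_1 \<Rightarrow> 'b::ring_1"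
  assumes h: "\<And>x y. h (x + y) = h x + h y" "\<And>x y. h (x - y) = h x - h y"
    "\<And>x y. h (x * y) = h x * h y"
  shows "racah_relators (h A) (h B) (h C) (h D) = h ` racah_relators A B C D"
  unfolding racah_relators_def image_Un comm_set_image[of h, OF h(2,3), symmetric]
  by (simp add: comm_def mult_2 h)

lemma daha_relators_image:
  fixes h :: "'a::ring_1 \<Rightarrow> 'b::ring_1"
  assumes h: "\<And>x y. h (x + y) = h x + h y" "\<And>x y. h (x - y) = h x - h y"
    "\<And>x y. h (x * y) = h x * h y" "h 1 = 1"
  shows "daha_relators (h a) (h b) (h c) (h d) = h ` daha_relators a b c d"
proof -
  have *: "{comm (x^2) g | x g. x \<in> S \<and> g \<in> T} = {comm x g | x g. x \<in> (\<lambda>x. x^2) ` S \<and> g \<in> T}"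
    for S T :: "'z::ring_1 set"
    by auto
  show ?thesis
    unfolding daha_relators_def * image_Un comm_set_image[of h, OF h(2,3), symmetric]
    by (simp add: power2_eq_square h)
qed

lemma abs_racah_simps:
  "abs_racah (p + q) = abs_racah p + abs_racah q"
  "abs_racah (p - q) = abs_racah p - abs_racah q"
  "abs_racah (p * q) = abs_racah p * abs_racah q"
  "abs_racah (gen Racah_A) = rA" "abs_racah (gen Racah_B) = rB"
  "abs_racah (gen Racah_C) = rC" "abs_racah (gen Racah_D) = rD"
  "abs_racah 1 = 1"
  by (simp_all add: plus_racah.abs_eq minus_racah.abs_eq times_racah.abs_eq
      rA_def rB_def rC_def rD_def one_racah_def)

lemma racah_relations:
  assumes "r \<in> racah_relators (rA :: 'f::field racah) rB rC rD"
  shows "r = 0"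
proof -
  have "abs_racah p = 0"
    if "p \<in> racah_relators (gen Racah_A :: (racah_gen, 'f) free_algebra)
      (gen Racah_B) (gen Racah_C) (gen Racah_D)" for p
    using two_sided_ideal.base[OF that] by (simp add: zero_racah_def racah.abs_eq_iff)
  moreover have "racah_relators (rA :: 'f racah) rB rC rD =
      abs_racah ` racah_relators (gen Racah_A) (gen Racah_B) (gen Racah_C) (gen Racah_D)"
    by (simp only: racah_relators_image[of abs_racah, OF abs_racah_simps(1-3), symmetric] abs_racah_simps)
  ultimately show ?thesis using assms by auto
qed

lemma abs_daha_simps:
  "abs_daha (p + q) = abs_daha p + abs_daha q"
  "abs_daha (p - q) = abs_daha p - abs_daha q"
  "abs_daha (p * q) = abs_daha p * abs_daha q"
  "abs_daha (gen Gen_t0) = t0" "abs_daha (gen Gen_t1) = t1"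
  "abs_daha (gen Gen_t0v) = t0v" "abs_daha (gen Gen_t1v) = t1v"
  "abs_daha 1 = 1"
  by (simp_all add: plus_daha.abs_eq minus_daha.abs_eq times_daha.abs_eq
      t0_def t1_def t0v_def t1v_def one_daha_def)

lemma daha_relations:
  assumes "r \<in> daha_relators (t0 :: 'f::field daha) t1 t0v t1v"
  shows "r = 0"
proof -
  have "abs_daha p = 0"
    if "p \<in> daha_relators (gen Gen_t0 :: (daha_gen, 'f) free_algebra)
      (gen Gen_t1) (gen Gen_t0v) (gen Gen_t1v)" for p
    using two_sided_ideal.base[OF that] by (simp add: zero_daha_def daha.abs_eq_iff)
  moreover have "daha_relators (t0 :: 'f daha) t1 t0v t1v =
      abs_daha ` daha_relators (gen Gen_t0) (gen Gen_t1) (gen Gen_t0v) (gen Gen_t1v)"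
    by (simp only: daha_relators_image[of abs_daha, OF abs_daha_simps(1-3) abs_daha_simps(8), symmetric] abs_daha_simps)
  ultimately show ?thesis using assms by auto
qed

section \<open>The homomorphism from the universal Racah algebra to the additive DAHA\<close>

lemma zeta_identity:
  fixes X Y P u v w z' :: "'a::ring_1"
  assumes X: "X*X = u" and Y: "Y*Y = v" and P: "P*P = w"
   and G: "Y*P+P*Y = z' - 2*X - 2*Y - 2*P - (X*Y+Y*X) - (X*P+P*X)"
   and cu: "X*u = u*X" "Y*u = u*Y" "P*u = u*P"
   and cv: "X*v = v*X" "Y*v = v*Y" "P*v = v*P"
   and cw: "X*w = w*X" "Y*w = w*Y" "P*w = w*P"
   and cz: "X*z' = z'*X" "Y*z' = z'*Y" "P*z' = z'*P"
   and A: "A = X*Y+Y*X" and B: "B = X*P+P*X"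
  shows "A*(A*B-B*A) - (A*B-B*A)*A
    = 8*(A*B+B*A+A*A) + 16*(X*A) + (16*u-16-8*z')*A + (16*u+16*v-16)*B
      + (32*u+32*v+16*z')*X - 16*(u*z') - 32*u"
proof -
  have X': "X*(X*t) = u*t" and Y': "Y*(Y*t) = v*t" and P': "P*(P*t) = w*t" for t
    by (simp_all add: X Y P mult.assoc[symmetric])
  have cc: "X*(u*t) = u*(X*t)" "Y*(u*t) = u*(Y*t)" "P*(u*t) = u*(P*t)"
     "X*(v*t) = v*(X*t)" "Y*(v*t) = v*(Y*t)" "P*(v*t) = v*(P*t)"
     "X*(w*t) = w*(X*t)" "Y*(w*t) = w*(Y*t)" "P*(w*t) = w*(P*t)"
     "X*(z'*t) = z'*(X*t)" "Y*(z'*t) = z'*(Y*t)" "P*(z'*t) = z'*(P*t)" for t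
    using cu cv cw cz by (simp_all add: mult.assoc[symmetric])
  have sq: "(x*x)*c = c*(x*x)" if "x*c = c*x" for x c :: 'a
    using that by (metis mult.assoc)
  have vu: "v*u = u*v" "z'*u = u*z'" "z'*v=v*z'" "w*u=u*w" "w*v=v*w" "z'*w=w*z'"
    using sq[OF cu(2)] sq[OF cz(1)] sq[OF cz(2)] sq[OF cu(3)] sq[OF cv(3)] sq[OF cz(3)]
    unfolding X Y P by simp_all
  have vu': "v*(u*t) = u*(v*t)" "z'*(u*t) = u*(z'*t)" "z'*(v*t)=v*(z'*t)" "w*(u*t)=u*(w*t)" 
    "w*(v*t)=v*(w*t)" "z'*(w*t)=w*(z'*t)" for t
    by (simp_all add: vu flip: mult.assoc)
  have num: "x * numeral k = numeral k * x" "x * (numeral k * y) = numeral k * (x * y)" 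
    for x y :: 'a and k
    by (metis mult_numeral_1 mult_of_nat_commute of_nat_numeral, 
        metis mult.assoc mult_of_nat_commute of_nat_numeral)
  have three: "3*x = x+x+x" for x :: 'a
    using distrib_right[of 2 1 x] by (simp add: mult_2)
  have four: "4*x = x+x+x+x" "2*x=x+x" "8*x = 4*x+4*x" "-4*x=-(4*x)" "-8*x=-(8*x)" for x :: 'a
    using distrib_right[of 2 2 x] distrib_right[of 4 4 x] by (simp_all add: mult_2)
  have sixteen: "16*x = 8*x+8*x" "32*x = 16*x+16*x" for x :: 'a
    using distrib_right[of 8 8 x] distrib_right[of 16 16 x] by simp_all
  note four = four three
  note N = algebra_simps X Y P X' Y' P' cu cv cw cz cc vu vu'
  define H where "H = Y*P+P*Y"
  have H1: "H = z' - 2*X - 2*Y - 2*P - A - B" unfolding H_def A B by (rule G)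
  have AX: "A*X = X*A" and AY: "A*Y = Y*A" unfolding A by (simp_all add: N)
  have BX: "B*X = X*B" and BP: "B*P = P*B" unfolding B by (simp_all add: N)
  have HY: "H*Y = Y*H" and HP: "H*P = P*H" unfolding H_def by (simp_all add: N)
  note two = num[of X] num[of Y] num[of P] num[of A] num[of B] num[of H] num[of u] num[of v] num[of z']
  define c where "c x y = x*y-y*x" for x y :: 'a
  have E1: "c A P = -2*(c (X+Y) P)"
  proof -
    have "c (H + 2*X+2*Y+2*P+A+B) P = 0" unfolding H1 c_def by (simp add: N)
    then show ?thesis using HP BP unfolding c_def by (simp add: algebra_simps two)
  qed
  have E2: "c B Y = -2*(c (X+P) Y)"
  proof -
    have "c (H + 2*X+2*Y+2*P+A+B) Y = 0" unfolding H1 c_def by (simp add: N)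
    then show ?thesis using HY AY unfolding c_def by (simp add: algebra_simps two)
  qed
  have E3: "c H X = -2*(c (Y+P) X)"
  proof -
    have "c (H + 2*X+2*Y+2*P+A+B) X = 0" unfolding H1 c_def by (simp add: N)
    then show ?thesis using AX BX unfolding c_def by (simp add: algebra_simps two)
  qed
  have S1: "c A B = X * c A P + c A P * X"
  proof -
    have "c A (X*P+P*X) = c A X * P + X * c A P + c A P * X + P * c A X"
      unfolding c_def by (simp add: algebra_simps)
    moreover have "c A X = 0" by (simp add: c_def AX)
    ultimately show ?thesis unfolding B by simp
  qed
  have S1': "c A B = -2*(X * c Y P + c Y P * X)"
    unfolding S1 E1 unfolding c_def by (simp add: N two)
  define K where "K = c Y (c X P) + c Y (c Y P)"
  have S2: "c A (c Y P) = -2*K"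
  proof -
    have "c A (c Y P) = c (c A Y) P + c Y (c A P)"
      unfolding c_def by (simp add: algebra_simps)
    moreover have "c A Y = 0" by (simp add: c_def AY)
    ultimately have "c A (c Y P) = c Y (c A P)" by (simp add: c_def)
    also have "\<dots> = c Y (-2*(c (X+Y) P))" unfolding E1 ..
    also have "\<dots> = -2*K" unfolding K_def c_def by (simp add: algebra_simps two)
    finally show ?thesis .
  qed
  have S3: "c A (c A B) = 4*(X*K+K*X)"
  proof -
    have "c A (c A B) = -2*(X * c A (c Y P) + c A (c Y P) * X) 
       -2*(c A X * c Y P + c Y P * c A X)"
      unfolding S1' unfolding c_def by (simp add: algebra_simps two)
    also have "c A X = 0" by (simp add: c_def AX)
    finally show ?thesis unfolding S2 by (simp add: algebra_simps num[of X])
  qed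
  have T1: "X * c Y (c X P) + c Y (c X P) * X 
     = A*B+B*A+4*(X*(A+B)) - 8*(u*(Y+P)) - 4*(u*H)"
  proof -
    have "X * c Y (c X P) + c Y (c X P) * X = A*X*P + P*X*A + Y*X*B + B*X*Y - 3*(u*H) - X*H*X"
      unfolding c_def A B H_def by (simp add: N three)
    also have "X*H*X = u*H + X * c H X" unfolding c_def by (simp add: N)
    also have "A*X*P + P*X*A + Y*X*B + B*X*Y = A*B+B*A + X*c A P + X* c B Y"
    proof -
      have "A*X*P + P*X*A = X*c A P + B*A" 
        unfolding AX c_def B by (simp add: algebra_simps AX)
      moreover have "B*X*Y + Y*X*B = X* c B Y + A*B"
        unfolding BX c_def A by (simp add: algebra_simps BX)
      ultimately show ?thesis by (simp add: algebra_simps)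
    qed
    also have "A*B+B*A + X*c A P + X* c B Y - 3*(u*H) - (u*H + X * c H X)
       = A*B+B*A+4*(X*(A+B)) - 8*(u*(Y+P)) - 4*(u*H)"
      unfolding E1 E2 E3 unfolding c_def A B by (simp add: N two four)
    finally show ?thesis .
  qed
  have T2: "X * c Y (c Y P) + c Y (c Y P) * X = 4*(v*B) - 2*(A*H) + 4*(Y*c (Y+P) X)"
  proof -
    have "X * c Y (c Y P) + c Y (c Y P) * X = 4*(v*B) - 2*(X*(Y*H)+Y*H*X)"
      unfolding c_def B H_def by (simp add: N four)
    also have "X*(Y*H)+Y*H*X = A*H + Y*c H X" unfolding c_def A by (simp add: algebra_simps four)
    finally show ?thesis unfolding E3 by (simp add: algebra_simps two four)
  qed
  have T3: "Y*c (Y+P) X = 2*(v*X) - A*Y - A*P + (X*(Y*P)+(Y*P)*X)"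
    unfolding c_def A by (simp add: N four)
  have T4: "4*(X*(Y*P)+(Y*P)*X) = 2*(X*H+H*X) - c A B"
    unfolding H_def S1' unfolding c_def by (simp add: algebra_simps four)
  have T5: "2*(X*H+H*X) = 4*(z'*X) - 8*u - 4*(A+B) - 4*(X*(A+B))"
  proof -
    show ?thesis unfolding H1 using AX BX cz X A B by (simp add: algebra_simps two four)
  qed
  have "c A (c A B) = 4*(A*B+B*A+4*(X*(A+B)) - 8*(u*(Y+P)) - 4*(u*H) + 4*(v*B) - 2*(A*H)
     + 8*(v*X) - 4*(A*Y) - 4*(A*P) + (4*(z'*X) - 8*u - 4*(A+B) - 4*(X*(A+B)) - c A B))"
  proof -
    have "X*K+K*X = (X * c Y (c X P) + c Y (c X P) * X) + (X * c Y (c Y P) + c Y (c Y P) * X)"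
      unfolding K_def by (simp add: distrib_left distrib_right)
    also have "\<dots> = (A*B+B*A+4*(X*(A+B)) - 8*(u*(Y+P)) - 4*(u*H)) +
       (4*(v*B) - 2*(A*H) + 4*(Y*c (Y+P) X))"
      unfolding T1 T2 ..
    also have "4*(Y*c (Y+P) X) = 8*(v*X) - 4*(A*Y) - 4*(A*P) + 4*(X*(Y*P)+(Y*P)*X)"
      unfolding T3 by (simp add: algebra_simps)
    also have "4*(X*(Y*P)+(Y*P)*X) = 4*(z'*X) - 8*u - 4*(A+B) - 4*(X*(A+B)) - c A B"
      unfolding T4 T5 ..
    finally have "X*K+K*X = A*B+B*A+4*(X*(A+B)) - 8*(u*(Y+P)) - 4*(u*H) + 4*(v*B) - 2*(A*H)
     + 8*(v*X) - 4*(A*Y) - 4*(A*P) + (4*(z'*X) - 8*u - 4*(A+B) - 4*(X*(A+B)) - c A B)"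
      by (simp only: add_diff_eq add.assoc[symmetric])
    then show ?thesis unfolding S3 by (rule arg_cong)
  qed
  also have "\<dots> = 8*(A*B+B*A+A*A) + 16*(X*A) + (16*u-16-8*z')*A + (16*u+16*v-16)*B
      + (32*u+32*v+16*z')*X - 16*(u*z') - 32*u"
  proof -
    have "A*z' = z'*A" unfolding A using cz by (simp add: N four)
    then show ?thesis unfolding H1 c_def using AX AY BX X cu by (simp add: algebra_simps two four sixteen)
  qed
  finally show ?thesis unfolding c_def .
qed


(* To be applied with X = t0 and {Y, P, Q} = {t1, t0v, t1v}: then a, b, c are 4 times the images
   of A, B, C, and the last claim is 128 times the relation for [A,D] + AC - BA.  The two other
   relations arise by permuting Y, P, Q cyclically. *)
lemma zeta_commute:
  fixes X Y P Q :: "'a::ring_1"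
  assumes sum: "X + Y + P + Q = -1"
    and central: "\<And>x g. x \<in> {X, Y, P, Q} \<Longrightarrow> g \<in> {X, Y, P, Q} \<Longrightarrow> x*x*g = g*(x*x)"
    and a: "a = (X*Y+Y*X)+X*X+Y*Y-1" and b: "b = (X*P+P*X)+X*X+P*P-1"
    and c: "c = (X*Q+Q*X)+X*X+Q*Q-1"
  shows "X*a = a*X" "X*b = b*X" "X*c = c*X"
    and "comm b c = comm a b" "comm c a = comm a b"
    and "g \<in> {a,b,c} \<Longrightarrow>
      (comm a (comm a b) + 8*(a*c) - 8*(b*a)) * g = g * (comm a (comm a b) + 8*(a*c) - 8*(b*a))"
proof -
  define u v w z where "u = X*X" and "v = Y*Y" and "w = P*P" and "z = Q*Q"
  note sq = u_def[symmetric] v_def[symmetric] w_def[symmetric] z_def[symmetric]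
  note fl = mult.assoc
  have cu: "X*u = u*X" "Y*u = u*Y" "P*u = u*P" "Q*u = u*Q"
    and cv: "X*v = v*X" "Y*v = v*Y" "P*v = v*P" "Q*v = v*Q"
    and cw: "X*w = w*X" "Y*w = w*Y" "P*w = w*P" "Q*w = w*Q"
    and cz: "X*z = z*X" "Y*z = z*Y" "P*z = z*P" "Q*z = z*Q"
    unfolding u_def v_def w_def z_def using central by auto
  have mc: "(x*y)*k = k*(x*y)" if "x*k=k*x" "y*k=k*y" for x y k :: 'a
    using that by (metis mult.assoc)
  have pc: "(x+y)*k = k*(x+y)" if "x*k=k*x" "y*k=k*y" for x y k :: 'a
    using that by (simp add: algebra_simps)
  have dc: "(x-y)*k = k*(x-y)" if "x*k=k*x" "y*k=k*y" for x y k :: 'a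
    using that by (simp add: algebra_simps)
  have nc: "numeral n*k = k*numeral n" for k :: 'a and n
    by (metis mult_of_nat_commute of_nat_numeral)
  have oc: "1*k = k*1" for k :: 'a by simp
  note cs = mc pc dc oc nc
  have uu: "v*u=u*v" "w*u=u*w" "z*u=u*z" "w*v=v*w" "z*v=v*z" "z*w=w*z"
    using mc[of Y u Y] mc[of P u P] mc[of Q u Q] mc[of P v P] mc[of Q v Q] mc[of Q w Q] cu cv cw
    unfolding sq by auto
  have abc: "x*k = k*x" if "x \<in> {a,b,c}" "X*k=k*X" "Y*k=k*Y" "P*k=k*P" "Q*k=k*Q" for x k
    using that unfolding a b c by (auto intro!: cs)
  show Xa: "X*a = a*X" and Xb: "X*b = b*X" and Xc: "X*c = c*X"
    unfolding a b c sq using cu cv cw cz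
    by (simp_all add: algebra_simps u_def)
  define S where "S = u+v+w+z-3"
  have Sc: "x*S = S*x" if "x \<in> {a,b,c,X}" for x
  proof -
    have "S*X=X*S" "S*Y=Y*S" "S*P=P*S" "S*Q=Q*S"
      unfolding S_def by ((intro cs)?; simp add: cu cv cw cz)+
    then have "X*S=S*X" "Y*S=S*Y" "P*S=S*P" "Q*S=S*Q" by simp_all
    then show ?thesis using that abc by auto
  qed
  have Q: "Q = -1-X-Y-P" using sum by (simp add: algebra_simps eq_diff_eq)
  have c': "c = S - 2*X - a - b"
  proof -
    have "X*(Y+P+Q)+(Y+P+Q)*X = -2*X-2*u"
      unfolding Q u_def by (simp add: algebra_simps mult_2 mult_2_right)
    then have "a+b+c = -2*X-2*u+3*u+v+w+z-3"
      unfolding a b c u_def v_def w_def z_def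
      using distrib_right[of 2 1 "X*X"] by (simp add: algebra_simps mult_2)
    then show ?thesis unfolding S_def using distrib_right[of 2 1 u] by (simp add: algebra_simps)
  qed
  have X2: "x*(2*X) = 2*(X*x)" if "x*X=X*x" for x
    using that nc[of num.One] by (metis mult.assoc nc)
  show "comm b c = comm a b" "comm c a = comm a b"
    unfolding c' comm_def using Sc[of a] Sc[of b] X2[OF Xa[symmetric]] X2[OF Xb[symmetric]]
    by (simp_all add: algebra_simps)
  define A B where "A = X*Y+Y*X" and "B = X*P+P*X"
  define z' where "z' = z-1-u-v-w"
  have z'c: "X*z'=z'*X" "Y*z'=z'*Y" "P*z'=z'*P"
    unfolding z'_def using cu cv cw cz by (simp_all add: algebra_simps)
  have G: "Y*P+P*Y = z' - 2*X - 2*Y - 2*P - (X*Y+Y*X) - (X*P+P*X)"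
    unfolding z'_def z_def Q u_def v_def w_def by (simp add: algebra_simps mult_2)
  note I = zeta_identity[OF sq(1-3) G cu(1-3) cv(1-3) cw(1-3) z'c A_def B_def]
  have aA: "a = A+(u+v-1)" and bB: "b = B+(u+w-1)"
    unfolding a b A_def B_def sq by simp_all
  have Ac: "A*k=k*A" "B*k=k*B" if "X*k=k*X" "Y*k=k*Y" "P*k=k*P" for k
    using that unfolding A_def B_def by (auto intro!: cs)
  have Au: "A*u=u*A" "A*v=v*A" "A*w=w*A" "A*z=z*A" "B*u=u*B" "B*v=v*B" "B*w=w*B" "B*z=z*B"
    using Ac cu cv cw cz by blast+
  have AX: "A*X = X*A" "B*X = X*B"
    using Xa Xb Au cu cv cw unfolding aA bB by (simp_all add: algebra_simps)
  have cab: "comm a (comm a b) = A*(A*B-B*A) - (A*B-B*A)*A"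
    unfolding comm_def aA bB using Au uu
    by (simp add: algebra_simps) (simp add: uu Au flip: mult.assoc)
  define E where "E = comm a (comm a b) + 8*(a*c) - 8*(b*a)"
  have E: "E = 16*((z-w)*X) + (8*((u+v-1)*((u+z-1)-2*u) - (u+w-1)*(u+v-1)) - 16*(u*z') - 32*u)"
  proof -
    have four: "4*x = x+x+x+x" "2*x=x+x" "8*x = 4*x+4*x" "-4*x=-(4*x)" "-8*x=-(8*x)" 
        "3*x=x+x+x" "16*x = 8*x+8*x" "32*x = 16*x+16*x" "24*x = 16*x+8*x" for x :: 'a
      using distrib_right[of 2 2 x] distrib_right[of 4 4 x] distrib_right[of 2 1 x]
        distrib_right[of 8 8 x] distrib_right[of 16 16 x] distrib_right[of 16 8 x] 
      by (simp_all add: mult_2)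
    have uu': "v*(u*t)=u*(v*t)" "w*(u*t)=u*(w*t)" "z*(u*t)=u*(z*t)" "w*(v*t)=v*(w*t)"
      "z*(v*t)=v*(z*t)" "z*(w*t)=w*(z*t)" for t
      using uu by (simp_all flip: mult.assoc)
    have Xk: "X*k = k*X" if "k \<in> {u,v,w,z}" for k using that cu cv cw cz by auto
    note nc' = nc[of _ A] nc[of _ B] nc[of _ X] nc[of _ u] nc[of _ v] nc[of _ w] nc[of _ z]
    show ?thesis
      unfolding E_def cab I c' unfolding aA bB S_def z'_def using cu cv cw cz
      by (simp add: algebra_simps Au uu uu' AX four nc'[symmetric])
  qed
  show "(comm a (comm a b) + 8*(a*c) - 8*(b*a)) * g = g * (comm a (comm a b) + 8*(a*c) - 8*(b*a))"
    if g: "g \<in> {a,b,c}"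
  proof -
    have "u*g=g*u" "v*g=g*v" "w*g=g*w" "z*g=g*z" "X*g=g*X"
      using abc[OF g cu] abc[OF g cv] abc[OF g cw] abc[OF g cz] g Xa Xb Xc by auto
    then have "E * g = g * E"
      unfolding E z'_def by (intro cs)
    then show ?thesis unfolding E_def .
  qed
qed
lemma daha_sum: "t0 + t1 + t0v + t1v = (-1 :: 'f::field daha)"
  using daha_relations[of "t0 + t1 + t0v + t1v + 1 :: 'f daha"]
  by (simp add: daha_relators_def eq_neg_iff_add_eq_0)

lemma daha_square_central:
  assumes "x \<in> {t0, t1, t0v, t1v}" "g \<in> {t0, t1, t0v, t1v :: 'f::field daha}"
  shows "x * x * g = g * (x * x)"
  using daha_relations[of "comm (x^2) g :: 'f daha"] assms
  by (auto simp: daha_relators_def comm_def power2_eq_square)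

lemma racah_2D: "2 * rD = comm rA (rB :: 'f::field racah)"
  using racah_relations[of "comm rA rB - 2 * rD :: 'f racah"] by (simp add: racah_relators_def)

(* The three prescribed images, and the resulting image of D = [A,B]/2. *)
fun zeta_gen :: "racah_gen \<Rightarrow> 'f::field_char_0 daha" where
  "zeta_gen Racah_A = daha_scale (1/4) ((t1v + t0v) * (t1v + t0v + 2))"
| "zeta_gen Racah_B = daha_scale (1/4) ((t1 + t1v) * (t1 + t1v + 2))"
| "zeta_gen Racah_C = daha_scale (1/4) ((t0v + t1) * (t0v + t1 + 2))"
| "zeta_gen Racah_D = daha_scale (1/2) (comm
    (daha_scale (1/4) ((t1v + t0v) * (t1v + t0v + 2)))
    (daha_scale (1/4) ((t1 + t1v) * (t1 + t1v + 2))))"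

lemma daha_comm_scale:
  "comm (daha_scale c x) y = daha_scale c (comm x y)"
  "comm x (daha_scale c y) = daha_scale c (comm x y)"
  for x y :: "'f::field daha"
  by (simp_all add: comm_def daha.scale_mult_left daha.scale_mult_right daha.scale_right_diff_distrib)

lemma daha_numeral_mult: "numeral n * x = daha_scale (numeral n) x" for x :: "'f::field daha"
proof -
  have "numeral n = daha_scale (numeral n) (1 :: 'f daha)"
  proof (induction n)
    case One
    show ?case by (simp only: numeral_One daha.scale_one)
  next
    case (Bit0 n)
    then show ?case by (metis numeral_Bit0 daha.scale_left_distrib)
  next
    case (Bit1 n)
    then show ?case by (metis numeral_Bit1 daha.scale_left_distrib daha.scale_one)
  qed
  then show ?thesis
    by (metis daha.scale_mult_left mult_1)
qed

lemma zeta_relator_aux: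
  fixes a b c :: "'f::field_char_0 daha"
  assumes E: "\<And>g. g \<in> {a,b,c} \<Longrightarrow>
      (comm a (comm a b) + 8*(a*c) - 8*(b*a)) * g = g * (comm a (comm a b) + 8*(a*c) - 8*(b*a))"
    and g: "g \<in> {daha_scale (1/4) a, daha_scale (1/4) b, daha_scale (1/4) c,
      daha_scale (1/32) (comm a b)}"
  shows "comm (comm (daha_scale (1/4) a) (daha_scale (1/32) (comm a b))
      + daha_scale (1/4) a * daha_scale (1/4) c - daha_scale (1/4) b * daha_scale (1/4) a) g = 0"
proof -
  let ?E = "comm a (comm a b) + 8*(a*c) - 8*(b*a)"
  have 1: "comm ?E g = 0" if "g \<in> {a,b,c}" for g
    using E[OF that] by (simp add: comm_def)
  have J: "comm x (comm y z) = comm (comm x y) z + comm y (comm x z)" for x y z :: "'f daha"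
    by (simp add: comm_def algebra_simps)
  have 2: "comm ?E (comm a b) = 0"
    unfolding J[of ?E] using 1[of a] 1[of b] by (simp add: comm_def)
  have 3: "comm ?E g = 0"
  proof -
    have "\<exists>c y. g = daha_scale c y \<and> comm ?E y = 0"
      using g 2 1[of a] 1[of b] 1[of c] by blast
    then show ?thesis
      by (elim exE conjE) (simp only: daha_comm_scale daha.scale_zero_right)
  qed
  have "comm (daha_scale (1/4) a) (daha_scale (1/32) (comm a b))
      + daha_scale (1/4) a * daha_scale (1/4) c - daha_scale (1/4) b * daha_scale (1/4) a
      = daha_scale (1/128) ?E"
    by (simp add: daha_comm_scale daha.scale_mult_left daha.scale_mult_right
        daha_numeral_mult daha.scale_right_distrib daha.scale_right_diff_distrib)
  then show ?thesis using 3 by (simp only: daha_comm_scale daha.scale_zero_right)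
qed

lemma zeta_relators:
  assumes "r \<in> racah_relators (zeta_gen Racah_A :: 'f::field_char_0 daha) (zeta_gen Racah_B)
    (zeta_gen Racah_C) (zeta_gen Racah_D)"
  shows "r = 0"
proof -
  define a b c :: "'f daha" where "a = (t0*t1+t1*t0)+t0*t0+t1*t1-1"
    and "b = (t0*t0v+t0v*t0)+t0*t0+t0v*t0v-1" and "c = (t0*t1v+t1v*t0)+t0*t0+t1v*t1v-1"
  have prod: "m*(m+2) = (x*y+y*x)+x*x+y*y-1" if "m = -1 - (x+y)" for m x y :: "'f daha"
    unfolding that by (simp add: algebra_simps)
  have s: "t1v + t0v = -1 - (t0 + t1 :: 'f daha)" "t1 + t1v = -1 - (t0 + t0v :: 'f daha)"
    "t0v + t1 = -1 - (t0 + t1v :: 'f daha)"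
    using daha_sum[where 'f = 'f] by (simp_all add: algebra_simps eq_diff_eq)
  have s1: "t0 + t0v + t1v + t1 = (-1 :: 'f daha)" and s2: "t0 + t1v + t1 + t0v = (-1 :: 'f daha)"
    using daha_sum[where 'f = 'f] by (simp_all add: ac_simps)
  note Z1 = zeta_commute[OF daha_sum daha_square_central a_def b_def c_def]
  have Z2: "(comm b (comm b c) + 8*(b*a) - 8*(c*b)) * g = g * (comm b (comm b c) + 8*(b*a) - 8*(c*b))"
    if "g \<in> {b,c,a}" for g
    using zeta_commute(6)[OF s1 daha_square_central b_def c_def a_def that] by (auto simp: insert_commute)
  have Z3: "(comm c (comm c a) + 8*(c*b) - 8*(a*c)) * g = g * (comm c (comm c a) + 8*(c*b) - 8*(a*c))"
    if "g \<in> {c,a,b}" for g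
    using zeta_commute(6)[OF s2 daha_square_central c_def a_def b_def that] by (auto simp: insert_commute)
  have gens: "zeta_gen Racah_A = daha_scale (1/4) a" "zeta_gen Racah_B = daha_scale (1/4) b"
    "zeta_gen Racah_C = daha_scale (1/4) c"
    unfolding a_def b_def c_def by (simp_all only: zeta_gen.simps prod[OF s(1)] prod[OF s(2)] prod[OF s(3)])
  have gD: "zeta_gen Racah_D = daha_scale (1/32) (comm a b)"
    unfolding zeta_gen.simps(4) unfolding zeta_gen.simps(1,2)[symmetric] unfolding gens by (simp add: daha_comm_scale)
  have D: "comm b c = comm a b" "comm c a = comm a b"
    using Z1(4,5) by auto
  note R1 = zeta_relator_aux[OF Z1(6)]
  note R2 = zeta_relator_aux[OF Z2, unfolded D(1)]
  note R3 = zeta_relator_aux[OF Z3, unfolded D(2)]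
  show ?thesis
    using assms unfolding racah_relators_def gens gD
  proof (elim UnE)
    assume "r \<in> {comm (daha_scale (1/4) a) (daha_scale (1/4) b) - 2 * daha_scale (1/32) (comm a b),
      comm (daha_scale (1/4) b) (daha_scale (1/4) c) - 2 * daha_scale (1/32) (comm a b),
      comm (daha_scale (1/4) c) (daha_scale (1/4) a) - 2 * daha_scale (1/32) (comm a b)}"
    then show "r = 0"
      by (auto simp: daha_comm_scale D daha_numeral_mult)
  qed (use R1 R2 R3 in fast)
qed

lemma zeta_ex1:
  "\<exists>!f. algebra_hom racah_scale (daha_scale :: 'f::field_char_0 \<Rightarrow> 'f daha \<Rightarrow> 'f daha) f \<and>
    f rA = daha_scale (1/4) ((t1v + t0v) * (t1v + t0v + 2)) \<and>
    f rB = daha_scale (1/4) ((t1 + t1v) * (t1 + t1v + 2)) \<and>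
    f rC = daha_scale (1/4) ((t0v + t1) * (t0v + t1 + 2))"
proof -
  let ?L = "free_lift daha_scale (zeta_gen :: _ \<Rightarrow> 'f daha)"
  define f where "f x = ?L (rep_racah x)" for x
  have L: "?L p = 0" if "p \<in> racah_ideal" for p
  proof (rule daha.free_lift_ideal[OF _ that])
    fix r :: "(racah_gen, 'f) free_algebra"
    assume "r \<in> racah_relators (gen Racah_A) (gen Racah_B) (gen Racah_C) (gen Racah_D)"
    then have "?L r \<in> racah_relators (?L (gen Racah_A)) (?L (gen Racah_B)) (?L (gen Racah_C))
        (?L (gen Racah_D))"
      by (subst racah_relators_image[of ?L]) (simp_all add: daha.free_lift_simps)
    then show "?L r = 0"
      by (intro zeta_relators) (simp only: daha.free_lift_gen)
  qed
  have f: "f (abs_racah p) = ?L p" for p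
  proof -
    have "rep_racah (abs_racah p) - p \<in> racah_ideal"
      using Quotient_abs_rep[OF Quotient_racah, of "abs_racah p"] by (simp only: racah.abs_eq_iff)
    then show ?thesis
      unfolding f_def using L[of "rep_racah (abs_racah p) - p"] by (simp add: daha.free_lift_diff)
  qed
  have f_scale: "f (racah_scale c x) = daha_scale c (f x)" for c x
    by (induct x rule: racah.abs_induct) (simp add: f racah_scale.abs_eq daha.free_lift_scale)
  have f_add: "f (x + y) = f x + f y" for x y
    by (induct x rule: racah.abs_induct, induct y rule: racah.abs_induct)
      (simp add: f daha.free_lift_add flip: abs_racah_simps)
  have f_mult: "f (x * y) = f x * f y" for x y
    by (induct x rule: racah.abs_induct, induct y rule: racah.abs_induct)
      (simp add: f daha.free_lift_mult flip: abs_racah_simps)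
  have f_gens: "f 1 = 1" "f rA = zeta_gen Racah_A" "f rB = zeta_gen Racah_B" "f rC = zeta_gen Racah_C"
    by (simp_all only: f daha.free_lift_gen daha.free_lift_one flip: abs_racah_simps)
  have hom: "algebra_hom racah_scale daha_scale f"
    unfolding algebra_hom_def
    by (auto simp: f_mult f_gens f_add f_scale intro!: linearI
        racah.vector_space_axioms daha.vector_space_axioms Vector_Spaces.linear.intro
        vector_space_pair.intro module_hom.intro module_hom_axioms.intro racah.module_axioms daha.module_axioms)
  show ?thesis
  proof (rule ex1I[of _ f])
    show "algebra_hom racah_scale daha_scale f \<and>
      f rA = daha_scale (1/4) ((t1v + t0v) * (t1v + t0v + 2)) \<and>
      f rB = daha_scale (1/4) ((t1 + t1v) * (t1 + t1v + 2)) \<and>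
      f rC = daha_scale (1/4) ((t0v + t1) * (t0v + t1 + 2))"
      using hom f_gens by simp
  next
    fix h :: "'f racah \<Rightarrow> 'f daha"
    assume h: "algebra_hom racah_scale daha_scale h \<and>
      h rA = daha_scale (1/4) ((t1v + t0v) * (t1v + t0v + 2)) \<and>
      h rB = daha_scale (1/4) ((t1 + t1v) * (t1 + t1v + 2)) \<and>
      h rC = daha_scale (1/4) ((t0v + t1) * (t0v + t1 + 2))"
    then have h_add: "h (x + y) = h x + h y" and h_scale: "h (racah_scale c x) = daha_scale c (h x)"
      and h_mult: "h (x * y) = h x * h y" and h_one: "h 1 = 1" for x y c
      by (auto simp: algebra_hom_def Vector_Spaces.linear_def module_hom.add module_hom.scale)
    have hABC: "h rA = f rA" "h rB = f rB" "h rC = f rC"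
      using h f_gens by simp_all
    have D: "rD = racah_scale (1/2) (rA * rB + racah_scale (-1) (rB * rA) :: 'f racah)"
    proof -
      have "rD = racah_scale (1/2) (2 * rD :: 'f racah)"
        by (simp add: mult_2 racah.scale_right_distrib flip: racah.scale_left_distrib)
      then show ?thesis
        unfolding racah_2D comm_def by simp
    qed
    have hD: "h rD = f rD"
      unfolding D by (simp only: h_scale h_add h_mult f_scale f_add f_mult hABC)
    show "h = f"
    proof
      fix x show "h x = f x"
        by (induction x rule: racah_induct)
          (simp_all add: h_add h_mult h_scale h_one f_add f_mult f_scale f_gens(1) hABC hD)
    qed
  qed
qed

definition zeta :: "'f::field_char_0 racah \<Rightarrow> 'f daha" where
  "zeta = (THE f. algebra_hom racah_scale daha_scale f \<and>
    f rA = daha_scale (1/4) ((t1v + t0v) * (t1v + t0v + 2)) \<and>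
    f rB = daha_scale (1/4) ((t1 + t1v) * (t1 + t1v + 2)) \<and>
    f rC = daha_scale (1/4) ((t0v + t1) * (t0v + t1 + 2)))"

lemma zeta:
  "algebra_hom racah_scale daha_scale zeta"
  "zeta rA = daha_scale (1/4) ((t1v + t0v) * (t1v + t0v + 2))"
  "zeta rB = daha_scale (1/4) ((t1 + t1v) * (t1 + t1v + 2))"
  "zeta rC = daha_scale (1/4) ((t0v + t1) * (t0v + t1 + 2))"
  using theI'[OF zeta_ex1] unfolding zeta_def[symmetric] by blast+

lemma zeta_simps:
  "zeta (x + y) = zeta x + zeta y" "zeta (x * y) = zeta x * zeta y" "zeta 1 = 1"
  "zeta (racah_scale c x) = daha_scale c (zeta x)"
  using zeta(1)
  by (auto simp: algebra_hom_def Vector_Spaces.linear_def intro: module_hom.add module_hom.scale)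

lemma zeta_pullback:
  assumes "algebra_module daha_scale scale act"
  shows "algebra_module racah_scale scale (\<lambda>r. act (zeta r))"
proof -
  interpret algebra_module daha_scale scale act by fact
  show ?thesis
    by unfold_locales
      (simp_all add: zeta_simps act_add_left act_add_right act_mult act_one act_scale_left
        act_scale_right)
qed

end

theory Submission
  imports Defs
begin

text \<open>Write \<open>X = t\<^sub>0\<close>, \<open>Y = t\<^sub>1\<close>, \<open>P = t\<^sub>0\<^sup>\<or>\<close>, and let \<open>R\<close> be the image of the Racah algebra acting on \<open>V\<close>.
  By Schur's lemma the squares of the generators act as scalars, so \<open>R\<close> is generated by
  \<open>A = XY + YX\<close>, \<open>B = XP + PX\<close> and \<open>X\<close>, and \<open>X\<close> is central in \<open>R\<close>.
  Hence \<open>X\<close> is a scalar on every irreducible \<open>R\<close>-submodule, which gives one direction.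

  Conversely, let \<open>X\<^sup>2 = k\<^sup>2\<close>. If \<open>k = 0\<close> and \<open>X\<close> is diagonalizable, then \<open>X = 0\<close> and \<open>R\<close> consists of scalars.
  If \<open>k\<close> is nonzero, \<open>V\<close> is the sum of the two eigenspaces of \<open>X\<close>, and each of them is \<open>R\<close>-irreducible
  or zero: for a nonzero \<open>R\<close>-submodule \<open>W\<close> of the \<open>k\<close>-eigenspace, the subspace \<open>W + YW + PW + PYW\<close>
  is invariant under all generators, hence equals \<open>V\<close>, while \<open>X + k\<close> maps it into \<open>W\<close>.\<close>

section \<open>Eigenvectors and Schur's lemma over an algebraically closed field\<close>

text \<open>Horner's scheme for the vector \<open>p(T) v\<close>.\<close>

definition poly_act ::
    "('f::field \<Rightarrow> 'v::ab_group_add \<Rightarrow> 'v) \<Rightarrow> ('v \<Rightarrow> 'v) \<Rightarrow> 'f poly \<Rightarrow> 'v \<Rightarrow> 'v" where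
  "poly_act scale T p v = fold_coeffs (\<lambda>a w. scale a v + T w) p 0"

text \<open>In finite dimension the iterates of \<open>T\<close> on \<open>v\<close> become
  dependent, so some nonzero polynomial in \<open>T\<close> kills \<open>v\<close>. Splitting off
  its linear factors one by one leads to an eigenvector.\<close>

lemma linear_eigenvector_exists:
  fixes scale :: "'f::alg_closed_field \<Rightarrow> 'v::ab_group_add \<Rightarrow> 'v" and T :: "'v \<Rightarrow> 'v" and v :: 'v
  assumes fd: "finite_dimensional scale"
    and add: "\<And>x y. T (x + y) = T x + T y" and scale: "\<And>c x. T (scale c x) = scale c (T x)"
    and v: "v \<noteq> 0"
  shows "\<exists>c x. x \<noteq> 0 \<and> T x = scale c x"
proof -
  obtain B where "finite_dimensional_vector_space scale B"
    using fd unfolding finite_dimensional_def by blast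
  then interpret finite_dimensional_vector_space scale B .
  have T0: "T 0 = 0"
    using add[of 0 0] by simp
  have pCons: "poly_act scale T (pCons a p) x = scale a x + T (poly_act scale T p x)" for a p x
    by (cases "a = 0 \<and> p = 0") (auto simp: poly_act_def T0)
  have zero: "poly_act scale T 0 x = 0" for x
    by (simp add: poly_act_def)
  have plus: "poly_act scale T (p + q) x = poly_act scale T p x + poly_act scale T q x" for p q x
    by (induction p q rule: poly_induct2) (simp_all add: zero pCons add scale_left_distrib)
  have smult: "poly_act scale T (smult c p) x = scale c (poly_act scale T p x)" for c p x
    by (induction p) (simp_all add: zero pCons scale scale_right_distrib)
  have minus: "poly_act scale T (p - q) x = poly_act scale T p x - poly_act scale T q x" for p q x
    using plus[of p "smult (-1) q"] smult[of "-1" q x] by simp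
  \<comment> \<open>For \<open>p = [:-c, 1:] * q\<close>, either \<open>q(T) v\<close> is zero and
    the degree has dropped, or it is an eigenvector for \<open>c\<close>.\<close>
  have root: "\<exists>c x. x \<noteq> 0 \<and> T x = scale c x" if "p \<noteq> 0" "poly_act scale T p v = 0" for p
    using that
  proof (induction "degree p" arbitrary: p rule: less_induct)
    case less
    show ?case
    proof (cases "degree p = 0")
      case True
      then obtain a where "p = [:a:]" by (meson degree_eq_zeroE)
      with less.prems v show ?thesis by (auto simp: pCons zero T0)
    next
      case False
      then obtain c where "poly p c = 0" using alg_closed_imp_poly_has_root by blast
      then obtain q where q: "p = [:-c, 1:] * q" by (auto simp: poly_eq_0_iff_dvd)
      with less.prems have "q \<noteq> 0" by auto
      then have "degree q < degree p" unfolding q by (subst degree_mult_eq) auto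
      moreover have "poly_act scale T p v = T (poly_act scale T q v) - scale c (poly_act scale T q v)"
        by (simp add: q plus smult pCons minus)
      ultimately show ?thesis
        using less.hyps[of q] less.prems \<open>q \<noteq> 0\<close> by (cases "poly_act scale T q v = 0") auto
    qed
  qed
  define S where "S i = (\<lambda>j. (T ^^ j) v) ` {..<i::nat}" for i
  have S_poly: "\<exists>p. (\<forall>j\<ge>i. coeff p j = 0) \<and> x = poly_act scale T p v" if "x \<in> span (S i)" for x i
    using that
  proof (induction rule: span_induct_alt)
    case base
    then show ?case by (intro exI[of _ 0]) (simp add: zero)
  next
    case (step c x y)
    then obtain p j where p: "\<forall>j\<ge>i. coeff p j = 0" "y = poly_act scale T p v" "j < i" "x = (T ^^ j) v"
      by (auto simp: S_def)
    have "(T ^^ j) v = poly_act scale T (monom 1 j) v"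
      by (induction j) (simp_all add: zero pCons T0 monom_0 monom_Suc)
    then show ?case
      using p by (intro exI[of _ "smult c (monom 1 j) + p"]) (auto simp: plus smult)
  qed
  \<comment> \<open>Otherwise \<open>S i\<close> would be independent with \<open>i\<close> elements
    for every \<open>i\<close>, also for \<open>i\<close> one above the dimension.\<close>
  have "\<exists>i. (T ^^ i) v \<in> span (S i)"
  proof (rule ccontr)
    assume *: "\<nexists>i. (T ^^ i) v \<in> span (S i)"
    have "independent (S i) \<and> card (S i) = i" for i
    proof (induction i)
      case 0
      then show ?case by (simp add: S_def independent_empty)
    next
      case (Suc i)
      moreover have "S (Suc i) = insert ((T ^^ i) v) (S i)"
        by (simp add: S_def lessThan_Suc)
      moreover have "(T ^^ i) v \<notin> S i" using * span_base by blast
      moreover have "finite (S i)" by (simp add: S_def)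
      ultimately show ?case using * independent_insertI by auto
    qed
    then have "Suc (dim UNIV) \<le> dim UNIV"
      by (metis independent_card_le_dim subset_UNIV)
    then show False by simp
  qed
  then obtain i p where p: "\<forall>j\<ge>i. coeff p j = 0" "(T ^^ i) v = poly_act scale T p v"
    using S_poly by metis
  have "(T ^^ i) v = poly_act scale T (monom 1 i) v"
    by (induction i) (simp_all add: zero pCons T0 monom_0 monom_Suc)
  then have "poly_act scale T (monom 1 i - p) v = 0" by (simp add: minus p(2))
  moreover have "coeff (monom 1 i - p) i \<noteq> 0" using p(1) by simp
  ultimately show ?thesis using root by (metis coeff_0)
qed

lemma (in algebra_module) act_zero_right: "act x 0 = 0"
  using act_scale_right[of x 0 0] by simp

lemma (in algebra_module) act_uminus_left: "act (- x) v = - act x v"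
  using act_scale_left[of "-1" x v] by simp

lemma (in algebra_module) act_diff_left: "act (x - y) v = act x v - act y v"
  using act_add_left[of x "- y" v] by (simp add: act_uminus_left)

lemma (in algebra_module) act_diff_right: "act x (v - w) = act x v - act x w"
  using act_add_right[of x "v - w" w] by simp

text \<open>An eigenspace of a central element is a submodule; a nonzero one is everything by
  irreducibility.\<close>

lemma schur_central:
  fixes scaleV :: "'f::alg_closed_field \<Rightarrow> 'v::ab_group_add \<Rightarrow> 'v"
  assumes "algebra_module scaleA scaleV act"
    and fd: "finite_dimensional scaleV"
    and irr: "algebra_module.irreducible_module scaleV act"
    and central: "\<And>x. z * x = x * z"
  shows "\<exists>c. \<forall>v. act z v = scaleV c v"
proof -
  interpret algebra_module scaleA scaleV act by fact
  have "UNIV \<noteq> {0 :: 'v}"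
    using irr by (simp add: irreducible_module_def irreducible_submodule_def)
  then obtain v :: 'v where "v \<noteq> 0" by auto
  then obtain c x where cx: "x \<noteq> 0" "act z x = scaleV c x"
    using linear_eigenvector_exists[OF fd, of "act z"] act_add_right act_scale_right
    by blast
  let ?E = "{v. act z v = scaleV c v}"
  have "submodule ?E"
    unfolding submodule_def V.subspace_def
    by (auto simp: act_add_right V.scale_right_distrib act_scale_right V.scale_left_commute
        act_zero_right) (metis act_mult act_scale_right central)
  moreover have "?E \<noteq> {0}" using cx by auto
  ultimately have "?E = UNIV"
    using irr unfolding irreducible_module_def irreducible_submodule_def by blast
  then show ?thesis by auto
qed

section \<open>Commutator identities in the additive DAHA\<close>

text \<open>Expanding \<open>Q * Q\<close> for \<open>Q = - 1 - X - Y - P\<close> gives the first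
  identity. An anticommutator commutes with both of its entries when their squares do, so commuting
  the first identity with \<open>Y\<close> or \<open>P\<close> cancels most terms and leads to the
  other two.\<close>

lemma
  fixes X Y P Q :: "'a::ring_1"
  assumes sum: "X + Y + P + Q = -1"
    and XX: "X * X = u" and YY: "Y * Y = v" and PP: "P * P = w" and QQ: "Q * Q = z"
    and cu: "\<And>g. g \<in> {X, Y, P} \<Longrightarrow> g * u = u * g"
    and cv: "\<And>g. g \<in> {X, Y, P} \<Longrightarrow> g * v = v * g"
    and cw: "\<And>g. g \<in> {X, Y, P} \<Longrightarrow> g * w = w * g"
    and cz: "\<And>g. g \<in> {X, Y, P} \<Longrightarrow> g * z = z * g"
    and A: "A = X * Y + Y * X" and B: "B = X * P + P * X"
  shows anticomm_YP: "Y * P + P * Y = z - 1 - u - v - w - 2 * X - 2 * Y - 2 * P - A - B"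
    and comm_BY: "comm B Y = - 2 * comm (X + P) Y"
    and comm_AB: "comm A B = - 2 * (X * comm Y P + comm Y P * X)"
proof -
  have two: "2 * x = x + x" "x * (2 * y) = x * y + x * y" "x * 2 = x + x" for x y :: 'a
    by (simp_all add: mult_2 mult_2_right distrib_left)
  have sq: "X * (X * t) = u * t" "Y * (Y * t) = v * t" "P * (P * t) = w * t" for t
    by (simp_all add: XX YY PP flip: mult.assoc)
  have "Q = - 1 - X - Y - P"
    using sum by (metis add_diff_cancel_left' diff_diff_add)
  then have "z = (- 1 - X - Y - P) * (- 1 - X - Y - P)"
    using QQ by simp
  then show G: "Y * P + P * Y = z - 1 - u - v - w - 2 * X - 2 * Y - 2 * P - A - B"
    by (simp add: A B algebra_simps XX YY PP two)
  have cc: "X * u = u * X" "Y * u = u * Y" "P * u = u * P" "X * v = v * X" "Y * v = v * Y"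
    "P * v = v * P" "X * w = w * X" "Y * w = w * Y" "P * w = w * P" "X * z = z * X"
    "Y * z = z * Y" "P * z = z * P"
    using cu cv cw cz by auto
  have cct: "X * (u * t) = u * (X * t)" "Y * (u * t) = u * (Y * t)" "P * (u * t) = u * (P * t)"
     "X * (v * t) = v * (X * t)" "Y * (v * t) = v * (Y * t)" "P * (v * t) = v * (P * t)"
     "X * (w * t) = w * (X * t)" "Y * (w * t) = w * (Y * t)" "P * (w * t) = w * (P * t)" for t
    using cc by (simp_all flip: mult.assoc)
  note N = algebra_simps XX YY PP sq cc cct
  have XA: "X * A = A * X" by (simp add: A N)
  have AY: "A * Y = Y * A" and BP: "B * P = P * B" by (simp_all add: A B N)
  define H where "H = Y * P + P * Y"
  have HY: "H * Y = Y * H" and HP: "H * P = P * H" by (simp_all add: H_def N)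
  have S: "H + 2 * X + 2 * Y + 2 * P + A + B = z - 1 - u - v - w"
    using G by (simp add: H_def algebra_simps)
  have "comm (H + 2 * X + 2 * Y + 2 * P + A + B) Y = 0"
    unfolding S by (simp add: comm_def algebra_simps cc)
  then show "comm B Y = - 2 * comm (X + P) Y"
    using AY HY by (simp add: comm_def algebra_simps two)
  have "comm (H + 2 * X + 2 * Y + 2 * P + A + B) P = 0"
    unfolding S by (simp add: comm_def algebra_simps cc)
  then have AP: "comm A P = - 2 * comm (X + Y) P"
    using BP HP by (simp add: comm_def algebra_simps two)
  have "comm A B = X * comm A P + comm A P * X"
    using XA unfolding B comm_def by (simp add: algebra_simps) (metis mult.assoc)
  \<comment> \<open>The share of \<open>X\<close> in \<open>comm (X + Y) P\<close> drops out:
    \<open>X * comm X P + comm X P * X\<close> is the commutator of \<open>X * X\<close> with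
    \<open>P\<close>.\<close>
  then show "comm A B = - 2 * (X * comm Y P + comm Y P * X)"
    unfolding AP by (simp add: comm_def N two)
qed

lemma daha_square_commute:
  fixes x y :: "'f::field daha"
  assumes "x \<in> {t0, t1, t0v, t1v}"
  shows "x * x * y = y * (x * x)"
proof (induction y rule: daha_induct)
  case (mult y z)
  then show ?case by (metis mult.assoc)
qed (use assms daha_square_central in
    \<open>auto simp: daha.scale_mult_left daha.scale_mult_right distrib_left distrib_right\<close>)

text \<open>Four times the image of \<open>rA\<close> up to central terms, in a form that visibly
  commutes with \<open>t0\<close>; \<open>daha_B\<close> plays the same role for
  \<open>rB\<close>.\<close>

definition daha_A :: "'f::field daha" where
  "daha_A = t0 * t1 + t1 * t0"

definition daha_B :: "'f::field daha" where
  "daha_B = t0 * t0v + t0v * t0"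

lemma daha_t1v_eq: "t1v = - 1 - t0 - t1 - (t0v :: 'f::field daha)"
  using daha_sum[where 'f = 'f] by (metis add_diff_cancel_left' diff_diff_add)

text \<open>By the sum relation each image is a quarter of \<open>m * (m + 2)\<close> with
  \<open>m = - 1 - (x + y)\<close>, which is \<open>(x + y)^2 - 1\<close>. Eliminating
  \<open>t1v\<close> from the anticommutator for \<open>rC\<close> leaves a linear term in
  \<open>t0\<close>, from which \<open>t0\<close> is recovered later.\<close>

lemma zeta_rA: "zeta rA = daha_scale (1/4) (daha_A + t0 * t0 + t1 * t1 - (1 :: 'f::field_char_0 daha))"
    and zeta_rB: "zeta rB = daha_scale (1/4) (daha_B + t0 * t0 + t0v * t0v - (1 :: 'f daha))"
    and zeta_rC: "zeta rC = daha_scale (1/4)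
      (- (2 * t0) - t0 * t0 - daha_A - daha_B + t1v * t1v - (1 :: 'f daha))"
proof -
  have prod: "m * (m + 2) = (x * y + y * x) + x * x + y * y - 1" if "m = -1 - (x + y)"
    for m x y :: "'f daha"
    unfolding that by (simp add: algebra_simps)
  have s: "t1v + t0v = -1 - (t0 + t1 :: 'f daha)" "t1 + t1v = -1 - (t0 + t0v :: 'f daha)"
    "t0v + t1 = -1 - (t0 + t1v :: 'f daha)"
    using daha_sum[where 'f = 'f] by (simp_all add: algebra_simps eq_diff_eq)
  show "zeta rA = daha_scale (1/4) (daha_A + t0 * t0 + t1 * t1 - (1 :: 'f daha))"
    and "zeta rB = daha_scale (1/4) (daha_B + t0 * t0 + t0v * t0v - (1 :: 'f daha))"
    by (simp_all add: zeta prod[OF s(1)] prod[OF s(2)] daha_A_def daha_B_def)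
  have "t0 * t1v + t1v * t0 = - (2 * t0) - 2 * (t0 * t0) - daha_A - (daha_B :: 'f daha)"
    unfolding daha_A_def daha_B_def daha_t1v_eq by (simp add: algebra_simps mult_2)
  then show "zeta rC = daha_scale (1/4)
      (- (2 * t0) - t0 * t0 - daha_A - daha_B + t1v * t1v - (1 :: 'f daha))"
    by (simp add: zeta prod[OF s(3)] mult_2)
qed

section \<open>An irreducible DAHA module and its pullback to the Racah algebra\<close>

locale irreducible_daha_module = algebra_module daha_scale scale act
  for scale :: "'f::{alg_closed_field, field_char_0} \<Rightarrow> 'v::ab_group_add \<Rightarrow> 'v"
    and act :: "'f daha \<Rightarrow> 'v \<Rightarrow> 'v" +
  assumes finite_dim: "finite_dimensional scale" and irreducible: "irreducible_module"
begin

sublocale R: algebra_module racah_scale scale "\<lambda>r. act (zeta r)"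
  by (rule zeta_pullback) (rule algebra_module_axioms)

lemma act_numeral_mult: "act (numeral n * x) v = scale (numeral n) (act x v)"
  by (simp add: daha_numeral_mult act_scale_left)

lemma act_numeral: "act (numeral n) v = scale (numeral n) v"
  using act_numeral_mult[of n 1 v] by (simp add: act_one)

lemmas act_simps = act_numeral act_add_left act_add_right act_diff_left act_diff_right act_uminus_left act_mult
  act_one act_scale_left act_scale_right act_numeral_mult act_zero_right

lemma square_scalar:
  assumes "x \<in> {t0, t1, t0v, t1v}"
  obtains c where "\<And>v. act x (act x v) = scale c v"
proof -
  have "\<exists>c. \<forall>v. act (x * x) v = scale c v"
    by (rule schur_central[OF algebra_module_axioms finite_dim irreducible])
      (rule daha_square_commute[OF assms])
  then show ?thesis using that by (auto simp: act_mult)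
qed

text \<open>Squares of generators act as scalars, so \<open>zeta_rA\<close>, \<open>zeta_rB\<close>
  and \<open>zeta_rC\<close> can be solved for \<open>daha_A\<close>, \<open>daha_B\<close> and
  \<open>t0\<close>.\<close>

lemma racah_submodule_iff:
  "R.submodule W \<longleftrightarrow>
    V.subspace W \<and> (\<forall>x\<in>W. act t0 x \<in> W \<and> act daha_A x \<in> W \<and> act daha_B x \<in> W)"
proof (intro iffI conjI ballI)
  obtain u v w z where sq: "\<And>x. act t0 (act t0 x) = scale u x" "\<And>x. act t1 (act t1 x) = scale v x"
    "\<And>x. act t0v (act t0v x) = scale w x" "\<And>x. act t1v (act t1v x) = scale z x"
    using square_scalar by (metis insertCI)
  note zeta_act = zeta_rA zeta_rB zeta_rC act_simps sq
  {
    assume W: "R.submodule W"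
    then show sub: "V.subspace W" by (simp add: R.submodule_def)
    note closed = V.subspace_add[OF sub] V.subspace_diff[OF sub] V.subspace_scale[OF sub]
      V.subspace_neg[OF sub]
    fix x assume x: "x \<in> W"
    have r: "act (zeta rA) x \<in> W" "act (zeta rB) x \<in> W" "act (zeta rC) x \<in> W"
      using W x by (auto simp: R.submodule_def)
    have "act daha_A x = scale 4 (act (zeta rA) x) - scale u x - scale v x + x"
      by (simp add: zeta_act)
    then show A: "act daha_A x \<in> W" using r x by (auto intro!: closed)
    have "act daha_B x = scale 4 (act (zeta rB) x) - scale u x - scale w x + x"
      by (simp add: zeta_act)
    then show B: "act daha_B x \<in> W" using r x by (auto intro!: closed)
    have "scale 2 (act t0 x) = - scale 4 (act (zeta rC) x) - scale u x - act daha_A x - act daha_B x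
        + scale z x - x"
      by (simp add: zeta_act)
    then have "act t0 x = scale (1/2) (- scale 4 (act (zeta rC) x) - scale u x - act daha_A x
        - act daha_B x + scale z x - x)"
      by (metis V.scale_scale V.scale_one nonzero_divide_eq_eq zero_neq_numeral)
    then show "act t0 x \<in> W" using A B r x by (auto intro!: closed)
  next
    assume W: "V.subspace W \<and> (\<forall>x\<in>W. act t0 x \<in> W \<and> act daha_A x \<in> W \<and> act daha_B x \<in> W)"
    then have sub: "V.subspace W" by simp
    note closed = V.subspace_add[OF sub] V.subspace_diff[OF sub] V.subspace_scale[OF sub]
      V.subspace_neg[OF sub]
    have gens: "act (zeta rA) x \<in> W" "act (zeta rB) x \<in> W" "act (zeta rC) x \<in> W" if "x \<in> W" for x
      using W that by (auto simp: zeta_act intro!: closed)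
    have "\<forall>x\<in>W. act (zeta r) x \<in> W" for r
    proof (induction r rule: racah_induct)
      case D
      \<comment> \<open>Closure under \<open>rD\<close> holds because it is half the commutator of
        \<open>rA\<close> and \<open>rB\<close>.\<close>
      have "act (zeta rD) x = scale (1/2) (act (zeta (2 * rD)) x)" for x
        by (simp add: mult_2 zeta_simps act_simps V.scale_right_distrib flip: V.scale_left_distrib)
      moreover have "zeta (2 * rD) = zeta rA * zeta rB - zeta rB * (zeta rA :: 'f daha)"
        unfolding racah_2D comm_def
        by (metis diff_add_cancel zeta_simps(1,2) add_diff_cancel)
      ultimately show ?case
        using gens by (auto simp: act_diff_left act_mult intro!: closed)
    qed (use gens in \<open>auto simp: zeta_simps act_simps intro!: closed\<close>)
    then show "R.submodule W" using sub by (simp add: R.submodule_def)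
  }
qed

lemma submoduleI:
  assumes sub: "V.subspace U"
    and gens: "\<And>x. x \<in> U \<Longrightarrow> act t0 x \<in> U" "\<And>x. x \<in> U \<Longrightarrow> act t1 x \<in> U" "\<And>x. x \<in> U \<Longrightarrow> act t0v x \<in> U"
  shows "submodule U"
proof -
  note closed = V.subspace_add[OF sub] V.subspace_diff[OF sub] V.subspace_scale[OF sub]
    V.subspace_neg[OF sub]
  have "\<forall>x\<in>U. act h x \<in> U" for h
  proof (induction h rule: daha_induct)
    case t1v
    show ?case unfolding daha_t1v_eq using gens by (auto simp: act_simps intro!: closed)
  qed (use gens in \<open>auto simp: act_simps intro!: closed\<close>)
  then show ?thesis using sub by (simp add: submodule_def)
qed

text \<open>The last equation is \<open>anticomm_YP\<close> with the squares turned into scalars; it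
  moves \<open>t0v\<close> to the left of \<open>t1\<close>.\<close>

lemma act_relations:
  obtains u v w c where
    "\<And>x. act t0 (act t0 x) = scale u x" "\<And>x. act t1 (act t1 x) = scale v x"
    "\<And>x. act t0v (act t0v x) = scale w x"
    "\<And>x. act t1 (act t0v x) = scale c x - scale 2 (act t0 x) - scale 2 (act t1 x)
      - scale 2 (act t0v x) - act daha_A x - act daha_B x - act t0v (act t1 x)"
proof -
  obtain u v w z where sq: "\<And>x. act t0 (act t0 x) = scale u x" "\<And>x. act t1 (act t1 x) = scale v x"
    "\<And>x. act t0v (act t0v x) = scale w x" "\<And>x. act t1v (act t1v x) = scale z x"
    using square_scalar by (metis insertCI)
  have "act (t1 * t0v + t0v * t1) x = act (t1v * t1v - 1 - t0 * t0 - t1 * t1 - t0v * t0v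
      - 2 * t0 - 2 * t1 - 2 * t0v - daha_A - daha_B) x" for x
    by (subst anticomm_YP[OF daha_sum refl refl refl refl _ _ _ _ daha_A_def daha_B_def])
      (use daha_square_commute[where 'f = 'f] in auto)
  then have "act t1 (act t0v x) = scale (z - 1 - u - v - w) x - scale 2 (act t0 x) - scale 2 (act t1 x)
      - scale 2 (act t0v x) - act daha_A x - act daha_B x - act t0v (act t1 x)" for x
    by (simp add: act_simps sq eq_diff_eq V.scale_left_diff_distrib)
  then show ?thesis using sq that by metis
qed

lemma act_t0_t1: "act t0 (act t1 x) = act daha_A x - act t1 (act t0 x)"
  and act_t0_t0v: "act t0 (act t0v x) = act daha_B x - act t0v (act t0 x)"
  by (simp_all add: daha_A_def daha_B_def act_simps)

text \<open>Moves \<open>daha_B\<close> past \<open>t1\<close>, so that it meets vectors of a Racah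
  submodule, which it preserves.\<close>

lemma act_daha_B_t1:
  "act daha_B (act t1 x) = act t1 (act daha_B x) - scale 2 (act t0 (act t1 x) - act t1 (act t0 x)
    + act t0v (act t1 x) - act t1 (act t0v x))"
proof -
  have "act (comm daha_B t1) x = act (- 2 * comm (t0 + t0v) t1) x"
    by (subst comm_BY[OF daha_sum refl refl refl refl _ _ _ _ daha_A_def daha_B_def])
      (use daha_square_commute[where 'f = 'f] in auto)
  then show ?thesis
    by (simp add: comm_def act_simps algebra_simps)
qed

text \<open>Here \<open>t1 * t0v\<close> and \<open>t0v * t1\<close> occur with opposite signs,
  while \<open>act_relations\<close> controls their sum; together they isolate one product.\<close>

lemma act_comm_daha_A_daha_B:
  "act daha_A (act daha_B x) - act daha_B (act daha_A x) =
    scale (- 2) (act t0 (act t1 (act t0v x)) - act t0 (act t0v (act t1 x))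
      + act t1 (act t0v (act t0 x)) - act t0v (act t1 (act t0 x)))"
proof -
  have "act (comm daha_A daha_B) x = act (- 2 * (t0 * comm t1 t0v + comm t1 t0v * t0)) x"
    by (subst comm_AB[OF daha_sum refl refl refl refl _ _ _ _ daha_A_def daha_B_def])
      (use daha_square_commute[where 'f = 'f] in auto)
  then show ?thesis
    by (simp add: comm_def act_simps algebra_simps)
qed

lemma act_t0_daha_A: "act t0 (act daha_A x) = act daha_A (act t0 x)"
  and act_t0_daha_B: "act t0 (act daha_B x) = act daha_B (act t0 x)"
proof -
  have "t0 * daha_A = daha_A * (t0 :: 'f daha)" "t0 * daha_B = daha_B * (t0 :: 'f daha)"
    using daha_square_commute[of t0 t1] daha_square_commute[of t0 t0v]
    by (simp_all add: daha_A_def daha_B_def algebra_simps)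
  then show "act t0 (act daha_A x) = act daha_A (act t0 x)"
    "act t0 (act daha_B x) = act daha_B (act t0 x)"
    by (metis act_mult)+
qed

section \<open>Generating the module from a Racah submodule\<close>

text \<open>The relations reorder any generator applied to one of the four translates of
  \<open>W\<close> back into their span, which is therefore a nonzero DAHA submodule.\<close>

lemma racah_submodule_generates:
  assumes W: "R.submodule W" "W \<noteq> {0}"
  shows "V.span (W \<union> act t1 ` W \<union> act t0v ` W \<union> (\<lambda>x. act t0v (act t1 x)) ` W) = UNIV"
    (is "V.span ?S = UNIV")
proof -
  obtain u v w c where sq: "\<And>x. act t0 (act t0 x) = scale u x" "\<And>x. act t1 (act t1 x) = scale v x"
    "\<And>x. act t0v (act t0v x) = scale w x"
    and YP: "\<And>x. act t1 (act t0v x) = scale c x - scale 2 (act t0 x) - scale 2 (act t1 x)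
      - scale 2 (act t0v x) - act daha_A x - act daha_B x - act t0v (act t1 x)"
    by (rule act_relations) blast
  have W_closed: "V.subspace W" "\<And>x. x \<in> W \<Longrightarrow> act t0 x \<in> W" "\<And>x. x \<in> W \<Longrightarrow> act daha_A x \<in> W"
    "\<And>x. x \<in> W \<Longrightarrow> act daha_B x \<in> W"
    using W(1) by (auto simp: racah_submodule_iff)
  have gen: "x \<in> V.span ?S" "act t1 x \<in> V.span ?S" "act t0v x \<in> V.span ?S"
    "act t0v (act t1 x) \<in> V.span ?S" if "x \<in> W" for x
    using that by (auto intro!: V.span_base)
  note closed = V.span_add V.span_diff V.span_scale V.span_neg
  have YPW: "act t1 (act t0v x) \<in> V.span ?S" if "x \<in> W" for x
    unfolding YP by (intro closed gen W_closed that)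
  have BYW: "act daha_B (act t1 x) \<in> V.span ?S" if "x \<in> W" for x
    unfolding act_daha_B_t1 act_t0_t1 by (intro closed gen YPW W_closed that)
  \<comment> \<open>Moving \<open>t0\<close> inward leaves \<open>daha_B (t1 x)\<close>, covered by
    \<open>BYW\<close>, and \<open>t0v\<close> applied to
    \<open>daha_A x - t1 (t0 x)\<close>.\<close>
  have XPYW: "act t0 (act t0v (act t1 x)) \<in> V.span ?S" if "x \<in> W" for x
    unfolding act_t0_t0v act_t0_t1 act_diff_right by (intro closed gen BYW W_closed that)
  \<comment> \<open>Solving \<open>YP\<close> for \<open>t0v (t1 x)\<close> first makes
    \<open>t1\<close> meet \<open>t1 (t0v x)\<close>, where its square is a scalar.\<close>
  have YPYW: "act t1 (act t0v (act t1 x)) \<in> V.span ?S" if "x \<in> W" for x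
  proof -
    have "act t0v (act t1 x) = scale c x - scale 2 (act t0 x) - scale 2 (act t1 x)
      - scale 2 (act t0v x) - act daha_A x - act daha_B x - act t1 (act t0v x)"
      by (simp add: YP)
    then have "act t1 (act t0v (act t1 x)) = act t1 (scale c x - scale 2 (act t0 x) - scale 2 (act t1 x)
      - scale 2 (act t0v x) - act daha_A x - act daha_B x - act t1 (act t0v x))"
      by (rule arg_cong)
    also have "\<dots> \<in> V.span ?S"
      unfolding act_diff_right act_scale_right sq by (intro closed gen YPW W_closed that)
    finally show ?thesis .
  qed
  have lift: "act h x \<in> V.span ?S"
    if "\<And>x. x \<in> W \<Longrightarrow> act h x \<in> V.span ?S" "\<And>x. x \<in> W \<Longrightarrow> act h (act t1 x) \<in> V.span ?S"
      "\<And>x. x \<in> W \<Longrightarrow> act h (act t0v x) \<in> V.span ?S"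
      "\<And>x. x \<in> W \<Longrightarrow> act h (act t0v (act t1 x)) \<in> V.span ?S" "x \<in> V.span ?S" for h x
    using that(5)
  proof (induction rule: V.span_induct_alt)
    case (step d x y)
    then have "act h x \<in> V.span ?S" using that(1-4) by auto
    then have "scale d (act h x) + act h y \<in> V.span ?S" using step(2) by (rule closed(1)[OF closed(3)])
    then show ?case by (simp add: act_simps)
  qed (simp add: act_simps V.span_zero)
  have "submodule (V.span ?S)"
  proof (rule submoduleI)
    have XYW: "act t0 (act t1 x) \<in> V.span ?S" and XPW: "act t0 (act t0v x) \<in> V.span ?S"
      if "x \<in> W" for x
      unfolding act_t0_t1 act_t0_t0v by (intro closed gen W_closed that)+
    show "act t0 x \<in> V.span ?S" if "x \<in> V.span ?S" for x
      by (rule lift[OF gen(1)[OF W_closed(2)] XYW XPW XPYW that])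
    show "act t1 x \<in> V.span ?S" if "x \<in> V.span ?S" for x
      by (rule lift[OF _ _ _ _ that]) (simp_all add: sq gen YPW YPYW V.span_scale)
    show "act t0v x \<in> V.span ?S" if "x \<in> V.span ?S" for x
      by (rule lift[OF _ _ _ _ that]) (simp_all add: sq gen V.span_scale)
  qed simp
  moreover have "V.span ?S \<noteq> {0}"
    using W(2) W_closed(1) gen(1) V.subspace_0 by blast
  ultimately show ?thesis
    using irreducible unfolding irreducible_module_def irreducible_submodule_def by blast
qed

section \<open>Eigenspaces of \<open>t0\<close> as Racah modules\<close>

lemma eigenspace_racah_submodule: "R.submodule {x. act t0 x = scale k x}"
  unfolding racah_submodule_iff V.subspace_def
  by (auto simp: act_simps V.scale_right_distrib V.scale_left_commute act_t0_daha_A act_t0_daha_B)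

text \<open>The operator \<open>?proj\<close>, that is \<open>t0 + k\<close>, acts on the eigenspace
  as the nonzero scalar \<open>2 * k\<close>. Once it sends all four translates of \<open>W\<close>
  into \<open>W\<close>, it sends the whole module there, so the eigenspace lies in
  \<open>W\<close>.\<close>

lemma eigenspace_racah_irreducible:
  assumes k: "k \<noteq> 0" and nonzero: "{x. act t0 x = scale k x} \<noteq> {0}"
  shows "R.irreducible_submodule {x. act t0 x = scale k x}" (is "R.irreducible_submodule ?E")
proof -
  have "W = ?E" if W: "R.submodule W" "W \<subseteq> ?E" "W \<noteq> {0}" for W
  proof
    obtain c where YP: "\<And>x. act t1 (act t0v x) = scale c x - scale 2 (act t0 x) - scale 2 (act t1 x)
      - scale 2 (act t0v x) - act daha_A x - act daha_B x - act t0v (act t1 x)"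
      by (rule act_relations) blast
    have sub: "V.subspace W" and W_closed: "\<And>x. x \<in> W \<Longrightarrow> act daha_A x \<in> W"
      "\<And>x. x \<in> W \<Longrightarrow> act daha_B x \<in> W"
      using W(1) by (auto simp: racah_submodule_iff)
    note closed = V.subspace_add[OF sub] V.subspace_diff[OF sub] V.subspace_scale[OF sub]
      V.subspace_neg[OF sub]
    let ?proj = "\<lambda>x. act t0 x + scale k x"
    have proj_simps: "?proj (x + y) = ?proj x + ?proj y" "?proj (x - y) = ?proj x - ?proj y"
      "?proj (scale d x) = scale d (?proj x)" for x y d
      by (simp_all add: act_simps algebra_simps V.scale_left_commute)
    have eig: "act t0 x = scale k x" if "x \<in> W" for x using W(2) that by auto
    have projW: "?proj x \<in> W" if "x \<in> W" for x
      using that by (auto simp: eig intro!: closed)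
    \<comment> \<open>As \<open>t0\<close> is \<open>k\<close> on \<open>W\<close>, composing
      \<open>?proj\<close> with \<open>t1\<close> or \<open>t0v\<close> gives the anticommutator
      with \<open>t0\<close>.\<close>
    have projY: "?proj (act t1 x) = act daha_A x" and projP: "?proj (act t0v x) = act daha_B x"
      if "x \<in> W" for x
      using eig[OF that] by (simp_all add: act_t0_t1 act_t0_t0v act_simps)
    have projPY: "?proj (act t0v (act t1 x)) \<in> W" if x: "x \<in> W" for x
    proof -
      \<comment> \<open>\<open>?n + ?m\<close> is controlled by \<open>YP\<close>, and
        \<open>?n - ?m\<close> is the commutator of \<open>daha_A\<close> and \<open>daha_B\<close>
        up to the factor -2.\<close>
      let ?m = "?proj (act t0v (act t1 x))" and ?n = "?proj (act t1 (act t0v x))"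
      have "?n + ?m = ?proj (scale c x - scale 2 (scale k x) - scale 2 (act t1 x)
          - scale 2 (act t0v x) - act daha_A x - act daha_B x)"
        unfolding proj_simps(1)[symmetric] by (simp add: YP eig[OF x])
      also have "\<dots> \<in> W"
        unfolding proj_simps(2,3) projY[OF x] projP[OF x]
        by (intro closed projW W_closed x)
      finally have plus: "?n + ?m \<in> W" .
      have "act daha_A (act daha_B x) - act daha_B (act daha_A x) = scale (- 2) (?n - ?m)"
        unfolding act_comm_daha_A_daha_B eig[OF x] by (simp add: act_simps algebra_simps)
      moreover have "act daha_A (act daha_B x) - act daha_B (act daha_A x) \<in> W"
        by (intro closed W_closed x)
      ultimately have minus: "scale (- 2) (?n - ?m) \<in> W" by simp
      have "?m = scale (1/4) (scale 2 (?n + ?m) + scale (- 2) (?n - ?m))"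
        by (simp add: algebra_simps flip: V.scale_left_distrib)
      then show ?thesis using plus minus by (metis closed(1,3))
    qed
    show "?E \<subseteq> W"
    proof
      fix y assume y: "y \<in> ?E"
      have "y \<in> V.span (W \<union> act t1 ` W \<union> act t0v ` W \<union> (\<lambda>x. act t0v (act t1 x)) ` W)"
        using racah_submodule_generates[OF W(1,3)] by simp
      then have "?proj y \<in> W"
      proof (induction rule: V.span_induct_alt)
        case base
        then show ?case using V.subspace_0[OF sub] by (simp add: act_simps)
      next
        case (step d x y)
        then have "?proj x \<in> W"
          using projW projY projP projPY W_closed by auto
        then show ?case unfolding proj_simps using step(2) by (rule closed(1)[OF closed(3)])
      qed
      then have "scale (2 * k) y \<in> W"
        using y by (simp flip: V.scale_left_distrib mult_2)
      then have "scale (1 / (2 * k)) (scale (2 * k) y) \<in> W" by (rule closed)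
      then show "y \<in> W" using k by simp
    qed
  qed (use W in auto)
  then show ?thesis
    using nonzero eigenspace_racah_submodule by (auto simp: R.irreducible_submodule_def)
qed

text \<open>An eigenspace of \<open>t0\<close> meets \<open>W\<close> in a Racah submodule, so one
  eigenvector inside \<open>W\<close> suffices. As \<open>t0 - k\<close> times \<open>t0 + k\<close>
  is zero for \<open>k ^ 2 = u\<close>, either \<open>t0 + k\<close> kills a given \<open>x\<close>
  or it maps \<open>x\<close> to an eigenvector, without leaving \<open>W\<close>.\<close>

lemma racah_irreducible_eigen:
  assumes W: "R.irreducible_submodule W"
  shows "\<exists>k. \<forall>x\<in>W. act t0 x = scale k x"
proof -
  obtain u where u: "\<And>x. act t0 (act t0 x) = scale u x"
    using square_scalar[of t0] by auto
  obtain k where k: "k ^ 2 = u" using nth_root_exists[of 2 u] by auto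
  have sub: "R.submodule W" "W \<noteq> {0}" using W by (auto simp: R.irreducible_submodule_def)
  then have subsp: "V.subspace W" and t0W: "\<And>x. x \<in> W \<Longrightarrow> act t0 x \<in> W"
    by (auto simp: racah_submodule_iff)
  obtain x where x: "x \<in> W" "x \<noteq> 0" using sub(2) V.subspace_0[OF subsp] by blast
  have "\<exists>k y. y \<in> W \<and> y \<noteq> 0 \<and> act t0 y = scale k y"
  proof (cases "act t0 x + scale k x = 0")
    case True
    then show ?thesis using x by (intro exI[of _ "-k"] exI[of _ x]) (simp add: eq_neg_iff_add_eq_0)
  next
    case False
    have "act t0 (act t0 x + scale k x) = scale k (act t0 x + scale k x)"
      by (simp add: act_simps u algebra_simps flip: k power2_eq_square)
    moreover have "act t0 x + scale k x \<in> W"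
      using x t0W subsp by (auto intro!: V.subspace_add V.subspace_scale)
    ultimately show ?thesis using False by blast
  qed
  then obtain k y where y: "y \<in> W" "y \<noteq> 0" "act t0 y = scale k y" by blast
  have "R.submodule (W \<inter> {x. act t0 x = scale k x})"
    using sub(1) eigenspace_racah_submodule[of k]
    by (auto simp: R.submodule_def intro: V.subspace_inter)
  then have "W \<inter> {x. act t0 x = scale k x} = W"
    using W y unfolding R.irreducible_submodule_def by blast
  then show ?thesis by auto
qed

section \<open>The two implications\<close>

text \<open>The irreducible summands consist of eigenvectors, so eigenvectors span, and a maximal
  independent set of them is a basis.\<close>

lemma diagonalizable_if_racah_completely_reducible:
  assumes "R.completely_reducible"
  shows "diagonalizable scale (act t0)"
proof -
  obtain \<S> where S: "\<forall>W\<in>\<S>. R.irreducible_submodule W" "V.span (\<Union>\<S>) = UNIV"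
    using assms by (auto simp: R.completely_reducible_def)
  let ?E = "{x. \<exists>k. act t0 x = scale k x}"
  have "\<Union>\<S> \<subseteq> ?E" using racah_irreducible_eigen S(1) by fast
  then have E: "V.span ?E = UNIV" using V.span_mono[of "\<Union>\<S>" ?E] S(2) by auto
  obtain B where B: "B \<subseteq> ?E" "V.independent B" "?E \<subseteq> V.span B"
    by (rule V.maximal_independent_subset)
  then have "V.span B = UNIV"
    using E V.span_minimal[of ?E "V.span B"] by auto
  then show ?thesis
    using B(1,2) unfolding diagonalizable_def by (intro exI[of _ B]) blast
qed

text \<open>\<open>daha_A\<close> and \<open>daha_B\<close> vanish along with \<open>t0\<close>, so
  every subspace is a Racah submodule and the lines through a basis give the decomposition.\<close>

lemma racah_completely_reducible_if_t0_zero: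
  assumes "\<And>x. act t0 x = 0"
  shows "R.completely_reducible"
proof -
  have submod: "R.submodule W \<longleftrightarrow> V.subspace W" for W
    using V.subspace_0[of W] assms by (auto simp: racah_submodule_iff daha_A_def daha_B_def act_simps)
  obtain B where B: "V.independent B" "V.span B = UNIV"
    by (rule V.maximal_independent_subset[of UNIV]) auto
  have mem: "b \<in> U" if "V.subspace U" "scale d b \<in> U" "d \<noteq> 0" for U b d
    using V.subspace_scale[OF that(1,2), of "1 / d"] that(3) by simp
  let ?S = "(\<lambda>b. V.span {b}) ` B"
  have nz: "b \<noteq> 0" if "b \<in> B" for b using B(1) V.dependent_zero that by blast
  have "R.irreducible_submodule (V.span {b})" if "b \<in> B" for b
    unfolding R.irreducible_submodule_def
  proof (intro conjI allI impI)
    show "V.span {b} \<noteq> {0}" using nz[OF that] V.span_base[of b "{b}"] by auto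
    fix U assume U: "R.submodule U \<and> U \<subseteq> V.span {b}"
    show "U = {0} \<or> U = V.span {b}"
    proof (cases "b \<in> U")
      case True
      then show ?thesis using U submod V.span_minimal[of "{b}" U] by blast
    next
      case False
      have "U \<subseteq> {0}"
      proof
        fix y assume "y \<in> U"
        then obtain d where "y = scale d b" using U V.span_singleton[of b] by auto
        then show "y \<in> {0}" using mem[of U d b] U submod \<open>y \<in> U\<close> False by auto
      qed
      then show ?thesis using U submod V.subspace_0 by blast
    qed
  qed (simp add: submod)
  moreover have "V.span {b} \<inter> V.span (\<Union>(?S - {V.span {b}})) = {0}" if "b \<in> B" for b
  proof -
    \<comment> \<open>A line different from that of \<open>b\<close> comes from a basis vector other
      than \<open>b\<close>.\<close>
    have "\<Union>(?S - {V.span {b}}) \<subseteq> V.span (B - {b})"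
      using V.span_mono[of "{_}" "B - {b}"] by fastforce
    then have "V.span (\<Union>(?S - {V.span {b}})) \<subseteq> V.span (B - {b})"
      by (simp add: V.span_minimal)
    moreover have "y = 0" if "y \<in> V.span {b}" "y \<in> V.span (B - {b})" for y
    proof -
      obtain d where "y = scale d b" using \<open>y \<in> V.span {b}\<close> V.span_singleton[of b] by auto
      moreover have "b \<notin> V.span (B - {b})" using B(1) \<open>b \<in> B\<close> by (auto simp: V.dependent_def)
      ultimately show ?thesis using mem[of "V.span (B - {b})" d b] that(2) by auto
    qed
    ultimately show ?thesis using V.span_zero by blast
  qed
  moreover have "V.span (\<Union>?S) = UNIV"
  proof -
    have "B \<subseteq> \<Union>?S" using V.span_base by blast
    then show ?thesis using B(2) V.span_mono[of B "\<Union>?S"] by auto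
  qed
  ultimately show ?thesis unfolding R.completely_reducible_def
    by (intro exI[of _ ?S]) blast
qed

lemma racah_completely_reducible_if_diagonalizable:
  assumes "diagonalizable scale (act t0)"
  shows "R.completely_reducible"
proof -
  obtain u where u: "\<And>x. act t0 (act t0 x) = scale u x"
    using square_scalar[of t0] by auto
  obtain k where k: "k ^ 2 = u" using nth_root_exists[of 2 u] by auto
  show ?thesis
  proof (cases "k = 0")
    case True
    then have u0: "u = 0" using k by simp
    obtain B where B: "V.span B = UNIV" "\<And>b. b \<in> B \<Longrightarrow> \<exists>c. act t0 b = scale c b"
      using assms unfolding diagonalizable_def by blast
    \<comment> \<open>The square of \<open>t0\<close> is zero here, so 0 is its only
      eigenvalue.\<close>
    have t0B: "act t0 b = 0" if b: "b \<in> B" for b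
    proof -
      obtain c where c: "act t0 b = scale c b" using B(2)[OF b] by blast
      then have "scale (c * c) b = 0" using u[of b] u0 by (simp add: act_simps)
      then show ?thesis using c by auto
    qed
    have "act t0 x = 0" if "x \<in> V.span B" for x
      using that by (induction rule: V.span_induct_alt) (auto simp: act_simps t0B)
    then show ?thesis using B(1) by (auto intro: racah_completely_reducible_if_t0_zero)
  next
    case False
    define E where "E c = {x. act t0 x = scale c x}" for c
    \<comment> \<open>A zero eigenspace has to be dropped, because irreducible submodules are
      nonzero.\<close>
    define \<S> where "\<S> = {E k, E (- k)} - {{0}}"
    have two: "scale k x - scale (- k) x = scale (2 * k) x" for x
      by (metis V.scale_left_diff_distrib diff_minus_eq_add mult_2)
    have meet: "x = 0" if "x \<in> E k" "x \<in> E (- k)" for x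
    proof -
      have "scale (2 * k) x = scale k x - scale (- k) x"
        by (simp only: two)
      also have "\<dots> = 0" using that by (simp add: E_def)
      finally show ?thesis using False by simp
    qed
    have sub: "V.subspace (E c)" for c
      using eigenspace_racah_submodule[of c] by (simp add: R.submodule_def E_def)
    have "R.irreducible_submodule W" if "W \<in> \<S>" for W
    proof -
      obtain c where c: "c \<in> {k, - k}" "W = E c" "E c \<noteq> {0}" using \<open>W \<in> \<S>\<close> by (auto simp: \<S>_def)
      then have "c \<noteq> 0" using False by auto
      then show ?thesis
        unfolding c(2) E_def by (rule eigenspace_racah_irreducible) (rule c(3)[unfolded E_def])
    qed
    moreover have "W \<inter> V.span (\<Union>(\<S> - {W})) = {0}" if "W \<in> \<S>" for W
    proof -
      obtain c where c: "c \<in> {k, - k}" "W = E c" using \<open>W \<in> \<S>\<close> by (auto simp: \<S>_def)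
      then have "\<Union>(\<S> - {W}) \<subseteq> E (- c)" by (auto simp: \<S>_def)
      then have "V.span (\<Union>(\<S> - {W})) \<subseteq> E (- c)" by (rule V.span_minimal) (rule sub)
      then show ?thesis using c meet V.span_zero V.subspace_0[OF sub] by auto
    qed
    moreover have "x \<in> V.span (\<Union>\<S>)" for x
    proof -
      have mem: "y \<in> V.span (\<Union>\<S>)" if "y \<in> E c" "c \<in> {k, - k}" for y c
        using that V.span_base[of y "\<Union>\<S>"] V.span_zero by (cases "E c = {0}") (auto simp: \<S>_def)
      \<comment> \<open>Since \<open>c * c = u\<close>, the operator \<open>t0 + c\<close> maps into
        \<open>E c\<close>. Subtracting its values for \<open>k\<close> and \<open>- k\<close>
        leaves \<open>2 * k\<close> times \<open>x\<close>.\<close>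
      have proj: "act t0 x + scale c x \<in> V.span (\<Union>\<S>)" if "c \<in> {k, - k}" for c
      proof (rule mem[OF _ that])
        have "c * c = u" using that k by (auto simp: power2_eq_square)
        then show "act t0 x + scale c x \<in> E c" by (simp add: E_def act_simps u algebra_simps)
      qed
      have "act t0 x + scale k x \<in> V.span (\<Union>\<S>)" "act t0 x + scale (- k) x \<in> V.span (\<Union>\<S>)"
        by (rule proj; simp)+
      then have "(act t0 x + scale k x) - (act t0 x + scale (- k) x) \<in> V.span (\<Union>\<S>)"
        by (rule V.span_diff)
      moreover have "(act t0 x + scale k x) - (act t0 x + scale (- k) x) = scale (2 * k) x"
        by (simp only: add_diff_cancel_left two)
      ultimately have "scale (1 / (2 * k)) (scale (2 * k) x) \<in> V.span (\<Union>\<S>)"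
        by (metis V.span_scale)
      then show ?thesis using False by simp
    qed
    then have "V.span (\<Union>\<S>) = UNIV" by auto
    ultimately show ?thesis unfolding R.completely_reducible_def
      by (intro exI[of _ \<S>] conjI ballI)
  qed
qed

end

theorem corollary5p3:
  fixes scale :: "'f::{alg_closed_field, field_char_0} \<Rightarrow> 'v::ab_group_add \<Rightarrow> 'v"
    and act :: "'f daha \<Rightarrow> 'v \<Rightarrow> 'v"
  assumes "algebra_module daha_scale scale act"
    and "finite_dimensional scale"
    and "algebra_module.irreducible_module scale act"
  shows "algebra_module.completely_reducible scale (\<lambda>r. act (zeta r)) \<longleftrightarrow>
         diagonalizable scale (act t0)"
proof -
  interpret irreducible_daha_module scale act
    using assms by (simp add: irreducible_daha_module_def irreducible_daha_module_axioms_def)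
  show ?thesis
    using diagonalizable_if_racah_completely_reducible racah_completely_reducible_if_diagonalizable
    by blast
qed

end
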